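(* Let $E$ be a function of the Hermite--Biehler class without real zeros and let $\mathcal{H}(E)$ be the corresponding de Branges space, with reproducing kernels $k_\lambda$, $\lambda\in\mathbb{C}$. Let $\Lambda_1\subset\mathbb{C}$ be such that the system of reproducing kernels $\{k_\lambda\}_{\lambda\in\Lambda_1}$ is incomplete in $\mathcal{H}(E)$. Then there exists a set $\Lambda_2\subset\mathbb{C}$ such that the system $\{k_\lambda\}_{\lambda\in\Lambda_1\cup\Lambda_2}$ is complete and minimal in $\mathcal{H}(E)$.
   Context: For an entire function $F$ put $F^*(z)=\overline{F(\overline{z})}$. An entire function $E$ is in the Hermite--Biehler class if $|E(z)|>|E^*(z)|$ for all $z\in\mathbb{C}_+=\{z:\operatorname{Im} z>0\}$. The de Branges space $\mathcal{H}(E)$ is the Hilbert space of all entire functions $F$ such that the restrictions of $F/E$ and $F^*/E$ to $\mathbb{C}_+$ belong to the Hardy space $H^2(\mathbb{C}_+)$, with inner product $$(F,G)_{\mathcal{H}(E)}=\int_{\mathbb{R}}\frac{F(t)\overline{G(t)}}{|E(t)|^2}\,dt.$$ The condition that $E$ has no real zeros corresponds to the requirement that for every $w\in\mathbb{C}$ there is $F\in\mathcal{H}(E)$ with $F(w)\neq 0$. Point evaluations are continuous on $\mathcal{H}(E)$, and for $w\in\mathbb{C}$ the reproducing kernel $k_w\in\mathcal{H}(E)$ is the element with $(F,k_w)_{\mathcal{H}(E)}=F(w)$ for all $F\in\mathcal{H}(E)$; explicitly, $$k_w(z)=\frac{\overline{E(w)}E(z)-\overline{E^*(w)}E^*(z)}{2\pi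 i(\overline{w}-z)}.$$ A system $\{v_j\}_{j\in J}$ in a Hilbert space $H$ is complete if its closed linear span equals $H$, and incomplete otherwise; it is minimal if no $v_{j_0}$ belongs to the closed linear span of $\{v_j\}_{j\in J\setminus\{j_0\}}$. The index sets $\Lambda_1,\Lambda_2$ are sets of distinct points. *)

theory Defs
  imports "HOL-Complex_Analysis.Complex_Analysis" "HOL-Library.Function_Algebras"
begin

definition sharp :: "(complex \<Rightarrow> complex) \<Rightarrow> complex \<Rightarrow> complex" where
  "sharp F = (\<lambda>z. cnj (F (cnj z)))"

definition hermite_biehler :: "(complex \<Rightarrow> complex) \<Rightarrow> bool" where
  "hermite_biehler E \<longleftrightarrow>
     E holomorphic_on UNIV \<and> (\<forall>z. Im z > 0 \<longrightarrow> norm (E z) > norm (sharp E z))"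

text \<open>
  The Hardy space \<open>H\<^sup>2\<close> of the upper half-plane. The elements are total functions
  of which only the values in the upper half-plane matter, so a function belongs to the set
  iff its restriction to the upper half-plane belongs to the Hardy space.
\<close>

definition hardy_space2 :: "(complex \<Rightarrow> complex) set" where
  "hardy_space2 = {f. f holomorphic_on {z. Im z > 0} \<and>
     (SUP y\<in>{0<..}. \<integral>\<^sup>+ x. ennreal ((norm (f (Complex x y)))\<^sup>2) \<partial>lborel) < \<infinity>}"

definition de_branges_space :: "(complex \<Rightarrow> complex) \<Rightarrow> (complex \<Rightarrow> complex) set" where
  "de_branges_space E = {F. F holomorphic_on UNIV \<and>
     (\<lambda>z. F z / E z) \<in> hardy_space2 \<and> (\<lambda>z. sharp F z / E z) \<in> hardy_space2}"

definition db_inner ::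
    "(complex \<Rightarrow> complex) \<Rightarrow> (complex \<Rightarrow> complex) \<Rightarrow> (complex \<Rightarrow> complex) \<Rightarrow> complex" where
  "db_inner E F G = (LINT t|lborel.
     F (complex_of_real t) * cnj (G (complex_of_real t)) /
       complex_of_real ((norm (E (complex_of_real t)))\<^sup>2))"

definition db_norm :: "(complex \<Rightarrow> complex) \<Rightarrow> (complex \<Rightarrow> complex) \<Rightarrow> real" where
  "db_norm E F = sqrt (Re (db_inner E F F))"

definition reproducing_kernel :: "(complex \<Rightarrow> complex) \<Rightarrow> complex \<Rightarrow> complex \<Rightarrow> complex" where
  "reproducing_kernel E w = (THE k. k \<in> de_branges_space E \<and>
     (\<forall>F\<in>de_branges_space E. db_inner E F k = F w))"

interpretation cfun: vector_space "\<lambda>(c::complex) (F :: complex \<Rightarrow> complex) z. c * F z"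
  by unfold_locales (simp_all add: fun_eq_iff algebra_simps)

text \<open>
  Systems are families \<open>v\<close> over an index set \<open>J\<close>, so that in the definition of minimality it is
  the index, not merely the vector, that is removed.
\<close>

definition closed_span ::
    "(complex \<Rightarrow> complex) \<Rightarrow> ('j \<Rightarrow> complex \<Rightarrow> complex) \<Rightarrow> 'j set \<Rightarrow> (complex \<Rightarrow> complex) set" where
  "closed_span E v J = {F \<in> de_branges_space E.
     \<forall>\<epsilon>>0. \<exists>G\<in>cfun.span (v ` J). db_norm E (F - G) < \<epsilon>}"

definition complete_system ::
    "(complex \<Rightarrow> complex) \<Rightarrow> ('j \<Rightarrow> complex \<Rightarrow> complex) \<Rightarrow> 'j set \<Rightarrow> bool" where
  "complete_system E v J \<longleftrightarrow> closed_span E v J = de_branges_space E"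

definition minimal_system ::
    "(complex \<Rightarrow> complex) \<Rightarrow> ('j \<Rightarrow> complex \<Rightarrow> complex) \<Rightarrow> 'j set \<Rightarrow> bool" where
  "minimal_system E v J \<longleftrightarrow> (\<forall>j\<in>J. v j \<notin> closed_span E v (J - {j}))"

end

theory Submission imports Defs begin

text \<open>
  Let \<open>M\<close> be the space of all \<open>F \<in> H(E)\<close> vanishing on \<open>\<Lambda>\<^sub>1\<close>; it is nonzero by incompleteness, and
  zeros outside \<open>\<Lambda>\<^sub>1\<close> can be divided out of it. Let \<open>K\<close> be the reproducing kernel of \<open>M\<close> at a real
  point \<open>x\<close> and put \<open>S(z) = (z - x) K(z)\<close>. This choice makes
  \<open>F \<mapsto> (F - F(u)/S(u) S) / (z - u)\<close> the resolvent at \<open>u\<close> of a symmetric operator on \<open>M\<close>, so its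
  norm is at most \<open>1/\<bar>Im u\<bar>\<close>, whence \<open>\<bar>F(u)/S(u)\<bar> \<le> A (1 + \<bar>u\<bar>) / \<bar>Im u\<bar>\<close> for every \<open>F \<in> M\<close>. This bound
  forces the zeros of \<open>S\<close> to be simple (at real points of \<open>\<Lambda>\<^sub>1\<close> this is arranged by the choice of
  \<open>x\<close>, which has to avoid a countable set), and, by Liouville's theorem, it forces every \<open>F \<in> M\<close>
  vanishing at all zeros of \<open>S\<close> to be a multiple of \<open>S\<close>. The zero set of \<open>S\<close>, with one further point
  added if \<open>S \<in> H(E)\<close>, is then complete and minimal; the functions \<open>S(z)/(z - \<lambda>)\<close> witness the
  minimality.
\<close>

text \<open>The inner product lives on the real axis, whereas membership in \<open>H\<close> bounds
  all horizontal lines; the two must be compared before any Hilbert space argument. Since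
  \<open>E\<close> has no zero in the closed upper half-plane, \<open>F / E\<close> is holomorphic
  up to the axis, and Cauchy's formula on rectangles gives the comparison.

  The point \<open>x\<close> is real so that multiplication by \<open>z - x\<close> is symmetric,
  and \<open>K\<close> is taken at \<open>x\<close> because functions of the form
  \<open>(z - x) P(z)\<close> in \<open>M\<close> are then orthogonal to it.

  The weak spot of the bound is the real axis, where it tolerates a simple pole of
  \<open>F / S\<close>. A double real zero of \<open>S\<close> outside
  \<open>\<Lambda>\<^sub>1\<close> would produce a double pole for some \<open>F\<close> and is
  excluded. At a real point of \<open>\<Lambda>\<^sub>1\<close>, however, every \<open>F\<close>
  already vanishes, so a double zero of \<open>S\<close> may leave only a simple pole. There
  \<open>K\<close> must have a nonzero derivative. That derivative is the conjugate of the value at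
  \<open>x\<close> of a nonzero function in \<open>M\<close>, so each point of
  \<open>\<Lambda>\<^sub>1\<close> forbids only countably many \<open>x\<close>.\<close>

section \<open>Boundary behaviour of Hardy space functions\<close>

lemma has_contour_integral_linepath_same_Im_iff:
  assumes "Im z = c" "Im z' = c" "Re z = a" "Re z' = b" "a < b"
  shows   "(f has_contour_integral I) (linepath z z') \<longleftrightarrow>
             ((\<lambda>x. f (Complex x c)) has_integral I) {a..b}"
proof -
  have "(f has_contour_integral I) (linepath z z') \<longleftrightarrow>
          ((\<lambda>x. f (linepath z z' x) * (z' - z)) has_integral I) {0..1}"
    by (subst has_contour_integral_linepath) simp_all
  also have "\<dots> \<longleftrightarrow> ((\<lambda>x. f ((a + (b - a) * x) + c *\<^sub>R \<i>) * (b - a)) has_integral I) {0..1}"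
    using assms
    by (intro has_integral_cong arg_cong2[of _ _ _ _ "(*)"] arg_cong[of _ _ f])
       (auto simp: linepath_def complex_eq_iff algebra_simps)
  also have "{0..1} = (\<lambda>x. x / (b - a)) ` {0..b-a}"
    using assms by simp
  also have "((\<lambda>x. f ((a + (b-a) * x) + c *\<^sub>R \<i>) * (b-a)) has_integral I) \<dots> \<longleftrightarrow>
             ((\<lambda>x. f ((a + x) + c *\<^sub>R \<i>) * (b-a)) has_integral ((b-a) *\<^sub>R I)) {0..b-a}"
    by (subst has_integral_stretch_real_iff) (use assms in simp_all)
  also have "\<dots> \<longleftrightarrow> ((\<lambda>x. of_real (b-a) * (f (x + c *\<^sub>R \<i>))) has_integral (b-a) *\<^sub>R I) {a..b}"
    by (subst has_integral_shift_real_ivl_iff[where c = "-a"])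
       (simp_all add: scaleR_conv_of_real mult_ac)
  also have "\<dots> \<longleftrightarrow> ((\<lambda>x. f (x + c *\<^sub>R \<i>)) has_integral I) {a..b}"
    by (subst has_integral_mult_right_iff) (use assms in \<open>auto simp: scaleR_conv_of_real\<close>)
  finally show ?thesis 
    by (simp add: scaleR_conv_of_real Complex_eq mult.commute)
qed

lemma ennreal_norm_integral_le:
  fixes h :: "real \<Rightarrow> complex"
  assumes "continuous_on {a..b} h" "(h has_integral I) {a..b}"
  shows "ennreal (norm I) \<le> (\<integral>\<^sup>+x. ennreal (norm (h x)) * indicator {a..b} x \<partial>lborel)"
proof -
  have si: "set_integrable lborel {a..b} h"
    using borel_integrable_atLeastAtMost' assms(1) by blast
  have "I = (LINT x:{a..b}|lborel. h x)"
    using set_borel_integral_eq_integral(2)[OF si] assms(2) by (simp add: integral_unique)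
  also have "\<dots> = (LINT x|lborel. indicator {a..b} x *\<^sub>R h x)"
    by (simp add: set_lebesgue_integral_def)
  finally have "ennreal (norm I) \<le> (\<integral>\<^sup>+x. ennreal (norm (indicator {a..b} x *\<^sub>R h x)) \<partial>lborel)"
    using integral_norm_bound_ennreal si unfolding set_integrable_def by metis
  also have "\<dots> = (\<integral>\<^sup>+x. ennreal (norm (h x)) * indicator {a..b} x \<partial>lborel)"
    by (intro nn_integral_cong) (auto simp: indicator_def)
  finally show ?thesis .
qed

text \<open>On the convex closed half-plane Cauchy's formula only asks \<open>w\<close> to be
  interior, so the base of the rectangle may lie on the real axis itself. Bounding each side by a
  nonnegative integral keeps integrability questions out of the later limit.\<close>

lemma cauchy_rectangle_bound:
  assumes g: "g holomorphic_on {z. 0 \<le> Im z}" and w: "\<bar>Re w\<bar> < R" "0 < Im w" "Im w < Y"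
  shows "ennreal (2 * pi * norm (g w)) \<le>
      (\<integral>\<^sup>+x. ennreal (norm (g (Complex x 0) / (Complex x 0 - w))) * indicator {-R..R} x \<partial>lborel)
    + (\<integral>\<^sup>+x. ennreal (norm (g (Complex x Y) / (Complex x Y - w))) * indicator {-R..R} x \<partial>lborel)
    + (\<integral>\<^sup>+y. ennreal (norm (g (Complex R y) / (Complex R y - w))) * indicator {0..Y} y \<partial>lborel)
    + (\<integral>\<^sup>+y. ennreal (norm (g (Complex (-R) y) / (Complex (-R) y - w))) * indicator {0..Y} y \<partial>lborel)"
proof -
  define S where "S = {z::complex. 0 \<le> Im z}"
  define p where "p = rectpath (Complex (-R) 0) (Complex R Y)"
  define h where "h = (\<lambda>z. g z / (z - w))"
  have R: "-R < R" "0 < Y" using w by auto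
  have conv: "convex S" unfolding S_def by (rule convex_halfspace_Im_ge)
  have "{z. 0 < Im z} \<subseteq> interior S"
    by (rule interior_maximal) (auto simp: S_def open_halfspace_Im_gt)
  then have wi: "w \<in> interior S" using w by auto
  have wb: "w \<in> box (Complex (-R) 0) (Complex R Y)"
    using w by (auto simp: in_box_complex_iff)
  have pim: "path_image p \<subseteq> S - {w}"
    unfolding p_def S_def using R w by (subst path_image_rectpath) auto
  have "(h has_contour_integral (2*pi * \<i> * winding_number p w * g w)) p"
    unfolding h_def
    by (rule Cauchy_integral_formula_convex_simple[OF conv _ wi _ pim])
       (use g in \<open>auto simp: S_def p_def\<close>)
  then have main: "(h has_contour_integral (2*pi * \<i> * g w)) p"
    unfolding p_def by (simp add: winding_number_rectpath[OF wb])
  have hc: "continuous_on (S - {w}) h"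
    unfolding h_def S_def
    by (intro continuous_intros holomorphic_on_imp_continuous_on holomorphic_on_subset[OF g]) auto
  \<comment> \<open>The corners run counterclockwise from the lower left. The upper and left sides
    are parametrised against the orientation, so that all integrals run over increasing
    intervals.\<close>
  define a1 a2 a3 a4 where "a1 = Complex (-R) 0" and "a2 = Complex R 0" and "a3 = Complex R Y"
    and "a4 = Complex (-R) Y"
  note a = a1_def a2_def a3_def a4_def
  have seg: "closed_segment a1 a2 \<subseteq> S - {w}" "closed_segment a2 a3 \<subseteq> S - {w}"
     "closed_segment a4 a3 \<subseteq> S - {w}" "closed_segment a1 a4 \<subseteq> S - {w}"
    using R w unfolding S_def a
    by (auto simp: closed_segment_same_Re closed_segment_same_Im closed_segment_eq_real_ivl)
  have ci: "h contour_integrable_on linepath u v" if "closed_segment u v \<subseteq> S - {w}" for u v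
    by (rule contour_integrable_continuous_linepath) (use hc that continuous_on_subset in blast)
  obtain I1 I2 I3 I4 where I: "(h has_contour_integral I1) (linepath a1 a2)" "(h has_contour_integral I2) (linepath a2 a3)"
      "(h has_contour_integral I3) (linepath a4 a3)" "(h has_contour_integral I4) (linepath a1 a4)"
    using seg[THEN ci] unfolding contour_integrable_on_def by blast
  have "(h has_contour_integral (I1 + (I2 + (-I3 + -I4)))) p"
    unfolding p_def rectpath_def Let_def
    using I has_contour_integral_reversepath[OF valid_path_linepath I(3)] has_contour_integral_reversepath[OF valid_path_linepath I(4)]
    unfolding a
    by (intro has_contour_integral_join) (assumption | simp)+
  then have eq: "2*pi * \<i> * g w = I1 + (I2 + (-I3 + -I4))"
    using main has_contour_integral_unique by blast
  have "2 * pi * norm (g w) = norm (I1 + (I2 + (-I3 + -I4)))"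
    unfolding eq[symmetric] by (simp add: norm_mult)
  also have "\<dots> \<le> norm I1 + norm I3 + norm I2 + norm I4"
    by (smt (verit) norm_triangle_ineq norm_minus_cancel)
  finally have "ennreal (2 * pi * norm (g w)) \<le> ennreal (norm I1 + norm I3 + norm I2 + norm I4)"
    by (rule ennreal_leI)
  also have "\<dots> = ennreal (norm I1) + ennreal (norm I3) + ennreal (norm I2) + ennreal (norm I4)"
    by simp
  also have "\<dots> \<le> (\<integral>\<^sup>+x. ennreal (norm (h (Complex x 0))) * indicator {-R..R} x \<partial>lborel)
    + (\<integral>\<^sup>+x. ennreal (norm (h (Complex x Y))) * indicator {-R..R} x \<partial>lborel)
    + (\<integral>\<^sup>+y. ennreal (norm (h (Complex R y))) * indicator {0..Y} y \<partial>lborel)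
    + (\<integral>\<^sup>+y. ennreal (norm (h (Complex (-R) y))) * indicator {0..Y} y \<partial>lborel)"
  proof (intro add_mono)
    have c: "continuous_on {a..b} (\<lambda>x. h (\<gamma> x))" if "continuous_on {a..b} \<gamma>" "\<gamma> ` {a..b} \<subseteq> S - {w}"
      for \<gamma> :: "real \<Rightarrow> complex" and a b
      using continuous_on_compose2[OF hc that] .
    have c1: "continuous_on X (\<lambda>x. Complex x y)" "continuous_on X (\<lambda>x. Complex y x)" for X y
      unfolding Complex_eq by (intro continuous_intros)+
    show "ennreal (norm I1) \<le> (\<integral>\<^sup>+x. ennreal (norm (h (Complex x 0))) * indicator {-R..R} x \<partial>lborel)"
      by (rule ennreal_norm_integral_le[OF c[OF c1(1)]])
       (use w R I(1) has_contour_integral_linepath_same_Im_iff[of a1 0 a2 "-R" R] in \<open>auto simp: a S_def\<close>)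
    show "ennreal (norm I3) \<le> (\<integral>\<^sup>+x. ennreal (norm (h (Complex x Y))) * indicator {-R..R} x \<partial>lborel)"
      by (rule ennreal_norm_integral_le[OF c[OF c1(1)]])
       (use w R I(3) has_contour_integral_linepath_same_Im_iff[of a4 Y a3 "-R" R] in \<open>auto simp: a S_def\<close>)
    \<comment> \<open>On a vertical side \<open>dz = i dy\<close>; the factor of modulus 1 is
      removed before the comparison.\<close>
    have n: "norm I = norm (-\<i> * I)" for I by (simp add: norm_mult)
    show "ennreal (norm I2) \<le> (\<integral>\<^sup>+y. ennreal (norm (h (Complex R y))) * indicator {0..Y} y \<partial>lborel)"
      by (subst n, rule ennreal_norm_integral_le[OF c[OF c1(2)]])
       (use w R I(2) has_contour_integral_linepath_same_Re_iff[of a2 R a3 0 Y] in \<open>auto simp: a S_def\<close>)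
    show "ennreal (norm I4) \<le> (\<integral>\<^sup>+y. ennreal (norm (h (Complex (-R) y))) * indicator {0..Y} y \<partial>lborel)"
      by (subst n, rule ennreal_norm_integral_le[OF c[OF c1(2)]])
       (use w R I(4) has_contour_integral_linepath_same_Re_iff[of a1 "-R" a4 0 Y] in \<open>auto simp: a S_def\<close>)
  qed
  finally show ?thesis unfolding h_def .
qed

section \<open>The Poisson kernel and the estimates it yields\<close>

lemma nn_integral_inverse_1_plus_square: "(\<integral>\<^sup>+x. ennreal (1 / (1 + x\<^sup>2)) \<partial>lborel) = ennreal pi"
proof -
  let ?h = "\<lambda>x::real. ennreal (1 / (1 + x\<^sup>2))"
  have 1: "(\<integral>\<^sup>+x. ?h x * indicator {0..} x \<partial>lborel) = ennreal (pi/2)"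
  proof -
    have d: "DERIV arctan x :> 1 / (1 + x\<^sup>2)" for x :: real
      using DERIV_arctan[of x] by (simp add: inverse_eq_divide)
    have "(\<integral>\<^sup>+x. ?h x * indicator {0..} x \<partial>lborel) = ennreal (pi/2 - arctan 0)"
      by (rule nn_integral_FTC_atLeast[OF _ d _ tendsto_arctan_at_top]) auto
    then show ?thesis by simp
  qed
  have 2: "(\<integral>\<^sup>+x. ?h x * indicator {..0} x \<partial>lborel) = ennreal (pi/2)"
  proof -
    have "(\<integral>\<^sup>+x. ?h x * indicator {..0} x \<partial>lborel) =
        ennreal \<bar>-1\<bar> * (\<integral>\<^sup>+x. ?h (0 + (-1) * x) * indicator {..0} (0 + (-1) * x) \<partial>lborel)"
      by (rule nn_integral_real_affine) auto
    also have "\<dots> = (\<integral>\<^sup>+x. ?h x * indicator {0..} x \<partial>lborel)"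
      by (simp add: indicator_def)
    finally show ?thesis using 1 by simp
  qed
  have "(\<integral>\<^sup>+x. ?h x \<partial>lborel) = (\<integral>\<^sup>+x. ?h x * indicator {0..} x + ?h x * indicator {..0} x \<partial>lborel)"
  proof (rule nn_integral_cong_AE)
    show "AE x in lborel. ?h x = ?h x * indicator {0..} x + ?h x * indicator {..0} x"
      using AE_lborel_singleton[of 0] by eventually_elim (simp add: indicator_def)
  qed
  also have "\<dots> = (\<integral>\<^sup>+x. ?h x * indicator {0..} x \<partial>lborel) + (\<integral>\<^sup>+x. ?h x * indicator {..0} x \<partial>lborel)"
    by (rule nn_integral_add) simp_all
  also have "\<dots> = ennreal (pi/2 + pi/2)"
    unfolding 1 2 by (rule ennreal_plus[symmetric]) simp_all
  finally show ?thesis by simp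
qed

text \<open>The integration variable is \<open>x\<close>, not the boundary variable
  \<open>t\<close>: this is the inner integral after the exchange in
  \<open>hardy_line_integral_le\<close>.\<close>

lemma nn_integral_poisson_kernel:
  assumes "0 < y"
  shows "(\<integral>\<^sup>+x. ennreal (y / pi / ((x - t)\<^sup>2 + y\<^sup>2)) \<partial>lborel) = 1"
proof -
  have "(\<integral>\<^sup>+x. ennreal (y / pi / ((x - t)\<^sup>2 + y\<^sup>2)) \<partial>lborel) =
      ennreal \<bar>y\<bar> * (\<integral>\<^sup>+x. ennreal (y / pi / ((t + y * x - t)\<^sup>2 + y\<^sup>2)) \<partial>lborel)"
    using assms by (subst nn_integral_real_affine[of _ y t]) auto
  also have "(\<integral>\<^sup>+x. ennreal (y / pi / ((t + y * x - t)\<^sup>2 + y\<^sup>2)) \<partial>lborel) =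
      (\<integral>\<^sup>+x. ennreal (1 / (pi * y)) * ennreal (1 / (1 + x\<^sup>2)) \<partial>lborel)"
  proof (intro nn_integral_cong)
    fix x :: real
    have "(t + y * x - t)\<^sup>2 + y\<^sup>2 = y\<^sup>2 * (1 + x\<^sup>2)" by (simp add: algebra_simps power_mult_distrib)
    then have "y / pi / ((t + y * x - t)\<^sup>2 + y\<^sup>2) = 1 / (pi * y) * (1 / (1 + x\<^sup>2))"
      using assms by (simp add: power2_eq_square)
    then show "ennreal (y / pi / ((t + y * x - t)\<^sup>2 + y\<^sup>2)) = ennreal (1 / (pi * y)) * ennreal (1 / (1 + x\<^sup>2))"
      using assms by (metis ennreal_mult'' divide_nonneg_nonneg zero_le_one add_nonneg_nonneg zero_le_power2)
  qed
  also have "\<dots> = ennreal (1 / (pi * y)) * ennreal pi"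
    by (subst nn_integral_cmult) (auto simp: nn_integral_inverse_1_plus_square)
  also have "ennreal \<bar>y\<bar> * \<dots> = 1"
    using assms by (simp add: ennreal_mult'[symmetric])
  finally show ?thesis .
qed

lemma continuous_on_Complex [continuous_intros]:
  assumes "continuous_on S f" "continuous_on S g"
  shows "continuous_on S (\<lambda>x. Complex (f x) (g x))"
  unfolding Complex_eq by (intro continuous_intros assms)

lemma measurable_Complex [measurable (raw)]:
  assumes [measurable]: "f \<in> borel_measurable M" "g \<in> borel_measurable M"
  shows "(\<lambda>x. Complex (f x) (g x)) \<in> borel_measurable M"
proof -
  have "(\<lambda>p. Complex (fst p) (snd p)) \<in> borel_measurable borel"
    by (intro borel_measurable_continuous_onI continuous_intros)
  then have "(\<lambda>p. Complex (fst p) (snd p)) \<in> borel_measurable (borel \<Otimes>\<^sub>M borel)"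
    by (simp add: borel_prod)
  from measurable_compose[OF measurable_Pair[OF assms] this] show ?thesis by simp
qed

text \<open>
  The vertical sides of the rectangle with corners \<open>\<plusminus>R\<close>, \<open>\<plusminus>R + \<i>n\<close> are controlled for a suitable
  \<open>R \<in> {n..2n}\<close>, by averaging over \<open>R\<close>.
\<close>

lemma hardy_vertical_sides:
  fixes f :: "complex \<Rightarrow> complex"
  assumes [measurable]: "f \<in> borel_measurable borel"
    and C: "\<And>y. 0 < y \<Longrightarrow> (\<integral>\<^sup>+x. ennreal ((norm (f (Complex x y)))\<^sup>2) \<partial>lborel) \<le> ennreal C"
    and n: "0 < n"
  shows "\<exists>R\<in>{n..2*n}. (\<integral>\<^sup>+y. ennreal ((norm (f (Complex R y)))\<^sup>2) * indicator {0..n} y \<partial>lborel)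
      + (\<integral>\<^sup>+y. ennreal ((norm (f (Complex (-R) y)))\<^sup>2) * indicator {0..n} y \<partial>lborel) \<le> ennreal (3 * \<bar>C\<bar> + 1)"
proof (rule ccontr)
  define u where "u = (\<lambda>x y. ennreal ((norm (f (Complex x y)))\<^sup>2))"
  define v where "v = (\<lambda>R. (\<integral>\<^sup>+y. u R y * indicator {0..n} y \<partial>lborel) + (\<integral>\<^sup>+y. u (-R) y * indicator {0..n} y \<partial>lborel))"
  have u1[measurable]: "(\<lambda>(x,y). u x y) \<in> borel_measurable (borel \<Otimes>\<^sub>M borel)"
    unfolding u_def by measurable
  assume "\<not> ?thesis"
  then have big: "v R \<ge> ennreal (3 * \<bar>C\<bar> + 1)" if "R \<in> {n..2*n}" for R
    using that by (force simp: v_def u_def)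
  \<comment> \<open>The strip has height \<open>n\<close> and \<open>R\<close> runs over an interval
    of length \<open>n\<close>. Each of the two vertical sides contributes at most
    \<open>|C| * n\<close> in total, so the mean of \<open>v\<close> is at most
    \<open>2 * |C|\<close>, which is less than \<open>3 * |C| + 1\<close>.\<close>
  have "ennreal (3 * \<bar>C\<bar> + 1) * ennreal n = (\<integral>\<^sup>+R. ennreal (3 * \<bar>C\<bar> + 1) * indicator {n..2*n} R \<partial>lborel)"
    using n by (subst nn_integral_cmult_indicator) auto
  also have "\<dots> \<le> (\<integral>\<^sup>+R. v R * indicator {n..2*n} R \<partial>lborel)"
    by (intro nn_integral_mono) (auto simp: indicator_def big simp del: ennreal_plus)
  also have "\<dots> \<le> (\<integral>\<^sup>+R. v R \<partial>lborel)"
    by (intro nn_integral_mono) (auto simp: indicator_def)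
  also have "\<dots> = (\<integral>\<^sup>+R. \<integral>\<^sup>+y. u R y * indicator {0..n} y \<partial>lborel \<partial>lborel)
      + (\<integral>\<^sup>+R. \<integral>\<^sup>+y. u (-R) y * indicator {0..n} y \<partial>lborel \<partial>lborel)"
    unfolding v_def by (subst nn_integral_add) auto
  also have "(\<integral>\<^sup>+R. \<integral>\<^sup>+y. u (-R) y * indicator {0..n} y \<partial>lborel \<partial>lborel) =
      (\<integral>\<^sup>+R. \<integral>\<^sup>+y. u R y * indicator {0..n} y \<partial>lborel \<partial>lborel)"
    by (subst (2) nn_integral_real_affine[where c = "-1" and t = 0]) auto
  also have "(\<integral>\<^sup>+R. \<integral>\<^sup>+y. u R y * indicator {0..n} y \<partial>lborel \<partial>lborel) =
      (\<integral>\<^sup>+y. \<integral>\<^sup>+R. u R y * indicator {0..n} y \<partial>lborel \<partial>lborel)"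
    by (rule lborel_pair.Fubini') measurable
  also have "\<dots> \<le> (\<integral>\<^sup>+y. ennreal \<bar>C\<bar> * indicator {0..n} y \<partial>lborel)"
  \<comment> \<open>Height 0 belongs to the strip but is not covered by \<open>C\<close>; it is a
    null set.\<close>
  proof (rule nn_integral_mono_AE)
    have "(\<integral>\<^sup>+R. u R y * indicator {0..n} y \<partial>lborel) \<le> ennreal \<bar>C\<bar> * indicator {0..n} y"
      if y: "y \<noteq> 0" for y
    proof -
      have "(\<integral>\<^sup>+R. u R y * indicator {0..n} y \<partial>lborel) = (\<integral>\<^sup>+R. u R y \<partial>lborel) * indicator {0..n} y"
        by (rule nn_integral_multc) measurable
      also have "\<dots> \<le> ennreal \<bar>C\<bar> * indicator {0..n} y"
      proof (cases "0 < y")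
        case True
        then have "(\<integral>\<^sup>+R. u R y \<partial>lborel) \<le> ennreal \<bar>C\<bar>"
          using order.trans[OF C[OF True] ennreal_leI[OF abs_ge_self]] by (simp add: u_def)
        then show ?thesis by (simp add: mult_right_mono)
      qed (use y in \<open>simp add: indicator_def\<close>)
      finally show ?thesis .
    qed
    then show "AE y in lborel. (\<integral>\<^sup>+R. u R y * indicator {0..n} y \<partial>lborel) \<le> ennreal \<bar>C\<bar> * indicator {0..n} y"
      using AE_lborel_singleton[of 0] by auto
  qed
  also have "\<dots> = ennreal (\<bar>C\<bar> * n)"
    using n by (subst nn_integral_cmult_indicator) (auto simp: ennreal_mult'')
  finally have "ennreal ((3 * \<bar>C\<bar> + 1) * n) \<le> ennreal (\<bar>C\<bar> * n) + ennreal (\<bar>C\<bar> * n)"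
    using n by (simp add: ennreal_mult'' add_mono)
  then have "ennreal ((3 * \<bar>C\<bar> + 1) * n) \<le> ennreal (2 * \<bar>C\<bar> * n)"
    using n by (subst (asm) ennreal_plus[symmetric]) (auto simp: algebra_simps)
  then have "(3 * \<bar>C\<bar> + 1) * n \<le> 2 * \<bar>C\<bar> * n"
    using n by (subst (asm) ennreal_le_iff) auto
  then show False using n by (simp add: mult_le_cancel_right)
qed


text \<open>Cauchy's formula for \<open>f\<^sup>2 / (z - cnj w)\<close> at \<open>w\<close>: the kernel becomes the Poisson kernel.\<close>

lemma hardy_poisson:
  assumes hol: "f holomorphic_on {z. 0 \<le> Im z}" and [measurable]: "f \<in> borel_measurable borel"
    and C: "\<And>y. 0 < y \<Longrightarrow> (\<integral>\<^sup>+x. ennreal ((norm (f (Complex x y)))\<^sup>2) \<partial>lborel) \<le> ennreal C"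
    and y: "0 < y"
  shows "ennreal ((norm (f (Complex x y)))\<^sup>2) \<le>
      (\<integral>\<^sup>+t. ennreal (y / pi / ((x - t)\<^sup>2 + y\<^sup>2)) * ennreal ((norm (f (Complex t 0)))\<^sup>2) \<partial>lborel)"
proof -
  define w where "w = Complex x y"
  define u where "u = (\<lambda>z. (norm (f z))\<^sup>2)"
  define g where "g = (\<lambda>z. (f z)\<^sup>2 / (z - cnj w))"
  have [measurable]: "u \<in> borel_measurable borel" unfolding u_def by measurable
  have u0: "0 \<le> u z" for z by (simp add: u_def)
  have gol: "g holomorphic_on {z. 0 \<le> Im z}"
    unfolding g_def by (intro holomorphic_intros hol) (use y in \<open>auto simp: w_def\<close>)
  have ng: "norm (g z / (z - w)) = u z / (norm (z - cnj w) * norm (z - w))" for z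
    by (simp add: g_def u_def norm_mult norm_divide norm_power)
  have gw: "norm (g w) = u w / (2 * y)"
  proof -
    have "w - cnj w = \<i> * of_real (2 * y)" by (simp add: w_def complex_eq_iff)
    then show ?thesis using y by (simp add: g_def u_def norm_mult norm_divide norm_power)
  qed
  define A where "A = (\<integral>\<^sup>+t. ennreal (u (Complex t 0) / ((x - t)\<^sup>2 + y\<^sup>2)) \<partial>lborel)"
  have key: "ennreal (2 * pi * norm (g w)) \<le> A + ennreal e" if e: "0 < e" for e
  proof -
    \<comment> \<open>The top side will contribute at most \<open>|C| / m^2\<close> and the two
      vertical sides together at most \<open>(3 * |C| + 1) / m^2\<close>; \<open>m\<close> makes the
      sum equal to \<open>e\<close>. The choice of \<open>n\<close> keeps these three sides at
      distance at least \<open>m\<close> from both \<open>w\<close> and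
      \<open>cnj w\<close>.\<close>
    define D where "D = 4 * \<bar>C\<bar> + 1"
    define m where "m = sqrt (D / e)"
    have m: "0 < m" "m\<^sup>2 = D / e" using e by (auto simp: m_def D_def)
    define n where "n = m + \<bar>x\<bar> + y"
    have n: "0 < n" using m y by (simp add: n_def)
    obtain R where R: "R \<in> {n..2*n}" "(\<integral>\<^sup>+y. ennreal (u (Complex R y)) * indicator {0..n} y \<partial>lborel)
      + (\<integral>\<^sup>+y. ennreal (u (Complex (-R) y)) * indicator {0..n} y \<partial>lborel) \<le> ennreal (3 * \<bar>C\<bar> + 1)"
      using hardy_vertical_sides[OF _ C n] unfolding u_def by auto
    have far: "norm (g z / (z - w)) \<le> 1 / m\<^sup>2 * u z" if "m \<le> norm (z - cnj w)" "m \<le> norm (z - w)" for z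
    proof -
      have "m\<^sup>2 \<le> norm (z - cnj w) * norm (z - w)"
        unfolding power2_eq_square using that m by (intro mult_mono) auto
      then have "u z / (norm (z - cnj w) * norm (z - w)) \<le> u z / m\<^sup>2"
        using m(1) u0[of z] by (intro divide_left_mono) (auto intro!: mult_pos_pos order.strict_trans2[OF m(1) that(1)] order.strict_trans2[OF m(1) that(2)])
      then show ?thesis unfolding ng by simp
    qed
    have "ennreal (2 * pi * norm (g w)) \<le>
      (\<integral>\<^sup>+x. ennreal (norm (g (Complex x 0) / (Complex x 0 - w))) * indicator {-R..R} x \<partial>lborel)
    + (\<integral>\<^sup>+x. ennreal (norm (g (Complex x n) / (Complex x n - w))) * indicator {-R..R} x \<partial>lborel)
    + (\<integral>\<^sup>+y. ennreal (norm (g (Complex R y) / (Complex R y - w))) * indicator {0..n} y \<partial>lborel)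
    + (\<integral>\<^sup>+y. ennreal (norm (g (Complex (-R) y) / (Complex (-R) y - w))) * indicator {0..n} y \<partial>lborel)"
      by (rule cauchy_rectangle_bound[OF gol]) (use R m y in \<open>auto simp: w_def n_def\<close>)
    also have "\<dots> \<le> A + ennreal (1 / m\<^sup>2) * ennreal \<bar>C\<bar>
       + ennreal (1 / m\<^sup>2) * (\<integral>\<^sup>+y. ennreal (u (Complex R y)) * indicator {0..n} y \<partial>lborel)
       + ennreal (1 / m\<^sup>2) * (\<integral>\<^sup>+y. ennreal (u (Complex (-R) y)) * indicator {0..n} y \<partial>lborel)"
    proof (intro add_mono)
      show "(\<integral>\<^sup>+x. ennreal (norm (g (Complex x 0) / (Complex x 0 - w))) * indicator {-R..R} x \<partial>lborel) \<le> A"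
        unfolding A_def
      proof (intro nn_integral_mono)
        fix t
        have "norm (Complex t 0 - cnj w) * norm (Complex t 0 - w) = (x - t)\<^sup>2 + y\<^sup>2"
          by (simp add: w_def cmod_def power2_commute)
        then show "ennreal (norm (g (Complex t 0) / (Complex t 0 - w))) * indicator {-R..R} t
          \<le> ennreal (u (Complex t 0) / ((x - t)\<^sup>2 + y\<^sup>2))"
          unfolding ng by (simp add: indicator_def)
      qed
      have "(\<integral>\<^sup>+x. ennreal (norm (g (Complex x n) / (Complex x n - w))) * indicator {-R..R} x \<partial>lborel)
          \<le> (\<integral>\<^sup>+x. ennreal (1 / m\<^sup>2) * ennreal (u (Complex x n)) \<partial>lborel)"
      proof (intro nn_integral_mono)
        fix t
        have "norm (g (Complex t n) / (Complex t n - w)) \<le> 1 / m\<^sup>2 * u (Complex t n)"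
          by (rule far; rule order.trans[OF _ abs_Im_le_cmod]) (use y in \<open>auto simp: w_def n_def\<close>)
        then show "ennreal (norm (g (Complex t n) / (Complex t n - w))) * indicator {-R..R} t
           \<le> ennreal (1 / m\<^sup>2) * ennreal (u (Complex t n))"
          by (auto simp: ennreal_mult'[symmetric] u0 indicator_def intro: ennreal_leI)
      qed
      also have "\<dots> = ennreal (1 / m\<^sup>2) * (\<integral>\<^sup>+x. ennreal (u (Complex x n)) \<partial>lborel)"
        by (rule nn_integral_cmult) measurable
      also have "\<dots> \<le> ennreal (1 / m\<^sup>2) * ennreal \<bar>C\<bar>"
        using order.trans[OF C[OF n] ennreal_leI[OF abs_ge_self]] unfolding u_def by (intro mult_left_mono) auto
      finally show "(\<integral>\<^sup>+x. ennreal (norm (g (Complex x n) / (Complex x n - w))) * indicator {-R..R} x \<partial>lborel) \<le> \<dots>" .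
      have side: "(\<integral>\<^sup>+y. ennreal (norm (g (Complex q y) / (Complex q y - w))) * indicator {0..n} y \<partial>lborel)
         \<le> ennreal (1 / m\<^sup>2) * (\<integral>\<^sup>+y. ennreal (u (Complex q y)) * indicator {0..n} y \<partial>lborel)" if "\<bar>q\<bar> = R" for q
      proof -
        have "(\<integral>\<^sup>+y. ennreal (norm (g (Complex q y) / (Complex q y - w))) * indicator {0..n} y \<partial>lborel)
           \<le> (\<integral>\<^sup>+y. ennreal (1 / m\<^sup>2) * (ennreal (u (Complex q y)) * indicator {0..n} y) \<partial>lborel)"
        proof (intro nn_integral_mono)
          fix t
          have "norm (g (Complex q t) / (Complex q t - w)) \<le> 1 / m\<^sup>2 * u (Complex q t)"
            by (rule far; rule order.trans[OF _ abs_Re_le_cmod]) (use y R that in \<open>auto simp: w_def n_def\<close>)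
          then show "ennreal (norm (g (Complex q t) / (Complex q t - w))) * indicator {0..n} t
           \<le> ennreal (1 / m\<^sup>2) * (ennreal (u (Complex q t)) * indicator {0..n} t)"
            by (auto simp: ennreal_mult'[symmetric] u0 indicator_def intro: ennreal_leI)
        qed
        also have "\<dots> = ennreal (1 / m\<^sup>2) * (\<integral>\<^sup>+y. ennreal (u (Complex q y)) * indicator {0..n} y \<partial>lborel)"
          by (rule nn_integral_cmult) measurable
        finally show ?thesis .
      qed
      show "(\<integral>\<^sup>+y. ennreal (norm (g (Complex R y) / (Complex R y - w))) * indicator {0..n} y \<partial>lborel)
         \<le> ennreal (1 / m\<^sup>2) * (\<integral>\<^sup>+y. ennreal (u (Complex R y)) * indicator {0..n} y \<partial>lborel)"
        "(\<integral>\<^sup>+y. ennreal (norm (g (Complex (-R) y) / (Complex (-R) y - w))) * indicator {0..n} y \<partial>lborel)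
         \<le> ennreal (1 / m\<^sup>2) * (\<integral>\<^sup>+y. ennreal (u (Complex (-R) y)) * indicator {0..n} y \<partial>lborel)"
        using R n by (auto intro!: side)
    qed
    also have "\<dots> \<le> A + ennreal (1 / m\<^sup>2) * ennreal \<bar>C\<bar> + ennreal (1 / m\<^sup>2) * ennreal (3 * \<bar>C\<bar> + 1)"
      unfolding add.assoc by (intro add_left_mono) (use R(2) in \<open>auto simp: distrib_left[symmetric] simp del: ennreal_plus intro: mult_left_mono\<close>)
    also have "\<dots> = A + ennreal (1 / m\<^sup>2 * \<bar>C\<bar> + 1 / m\<^sup>2 * (3 * \<bar>C\<bar> + 1))"
      by (simp only: ennreal_mult''[symmetric] ennreal_plus[symmetric] add.assoc abs_ge_zero
            mult_nonneg_nonneg divide_nonneg_nonneg zero_le_power2 zero_le_one add_nonneg_nonneg zero_le_numeral)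
    also have "1 / m\<^sup>2 * \<bar>C\<bar> + 1 / m\<^sup>2 * (3 * \<bar>C\<bar> + 1) = e"
      using m e by (simp add: D_def field_simps)
    finally show ?thesis .
  qed
  have "ennreal (2 * pi * norm (g w)) \<le> A"
    by (rule ennreal_le_epsilon) (use key in auto)
  then have "ennreal (y / pi) * ennreal (2 * pi * norm (g w)) \<le> ennreal (y / pi) * A"
    by (rule mult_left_mono) simp
  moreover have "ennreal (y / pi) * ennreal (2 * pi * norm (g w)) = ennreal (u w)"
    unfolding gw using y u0[of w] by (simp add: ennreal_mult'[symmetric])
  moreover have "ennreal (y / pi) * A =
      (\<integral>\<^sup>+t. ennreal (y / pi / ((x - t)\<^sup>2 + y\<^sup>2)) * ennreal (u (Complex t 0)) \<partial>lborel)"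
    unfolding A_def
  proof (subst nn_integral_cmult[symmetric])
    show "(\<integral>\<^sup>+t. ennreal (y / pi) * ennreal (u (Complex t 0) / ((x - t)\<^sup>2 + y\<^sup>2)) \<partial>lborel) =
      (\<integral>\<^sup>+t. ennreal (y / pi / ((x - t)\<^sup>2 + y\<^sup>2)) * ennreal (u (Complex t 0)) \<partial>lborel)"
      using y u0 by (intro nn_integral_cong) (simp add: ennreal_mult''[symmetric] ennreal_mult'[symmetric] add_nonneg_nonneg)
  qed measurable
  ultimately show ?thesis by (simp add: u_def w_def)
qed

text \<open>Integrating the Poisson inequality over \<open>x\<close> and exchanging the integrals
  uses up the kernel, which has mass 1. The unspecified bound \<open>C\<close> is thereby replaced
  by the boundary integral.\<close>

lemma hardy_line_integral_le:
  assumes hol: "f holomorphic_on {z. 0 \<le> Im z}" and [measurable]: "f \<in> borel_measurable borel"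
    and C: "\<And>y. 0 < y \<Longrightarrow> (\<integral>\<^sup>+x. ennreal ((norm (f (Complex x y)))\<^sup>2) \<partial>lborel) \<le> ennreal C"
    and y: "0 < y"
  shows "(\<integral>\<^sup>+x. ennreal ((norm (f (Complex x y)))\<^sup>2) \<partial>lborel) \<le> (\<integral>\<^sup>+t. ennreal ((norm (f (Complex t 0)))\<^sup>2) \<partial>lborel)"
proof -
  let ?P = "\<lambda>x t. ennreal (y / pi / ((x - t)\<^sup>2 + y\<^sup>2))" and ?u = "\<lambda>t. ennreal ((norm (f (Complex t 0)))\<^sup>2)"
  have "(\<integral>\<^sup>+x. ennreal ((norm (f (Complex x y)))\<^sup>2) \<partial>lborel) \<le> (\<integral>\<^sup>+x. \<integral>\<^sup>+t. ?P x t * ?u t \<partial>lborel \<partial>lborel)"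
    by (intro nn_integral_mono hardy_poisson[OF hol _ C y]) auto
  also have "\<dots> = (\<integral>\<^sup>+t. \<integral>\<^sup>+x. ?P x t * ?u t \<partial>lborel \<partial>lborel)"
    by (rule lborel_pair.Fubini') measurable
  also have "\<dots> = (\<integral>\<^sup>+t. ?u t \<partial>lborel)"
  proof (intro nn_integral_cong)
    fix t
    have "(\<integral>\<^sup>+x. ?P x t * ?u t \<partial>lborel) = (\<integral>\<^sup>+x. ?P x t \<partial>lborel) * ?u t"
      by (rule nn_integral_multc) measurable
    then show "(\<integral>\<^sup>+x. ?P x t * ?u t \<partial>lborel) = ?u t"
      unfolding nn_integral_poisson_kernel[OF y] by simp
  qed
  finally show ?thesis .
qed

text \<open>The Poisson kernel at height \<open>y\<close> is at most \<open>1 / (pi * y)\<close>;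
  the weaker \<open>1 / y\<close> suffices.\<close>

lemma hardy_pointwise_le:
  assumes hol: "f holomorphic_on {z. 0 \<le> Im z}" and [measurable]: "f \<in> borel_measurable borel"
    and C: "\<And>y. 0 < y \<Longrightarrow> (\<integral>\<^sup>+x. ennreal ((norm (f (Complex x y)))\<^sup>2) \<partial>lborel) \<le> ennreal C"
    and w: "0 < Im w"
  shows "ennreal ((norm (f w))\<^sup>2) \<le> ennreal (1 / Im w) * (\<integral>\<^sup>+t. ennreal ((norm (f (Complex t 0)))\<^sup>2) \<partial>lborel)"
proof -
  let ?u = "\<lambda>t. ennreal ((norm (f (Complex t 0)))\<^sup>2)"
  have "ennreal ((norm (f (Complex (Re w) (Im w))))\<^sup>2) \<le>
     (\<integral>\<^sup>+t. ennreal (Im w / pi / ((Re w - t)\<^sup>2 + (Im w)\<^sup>2)) * ?u t \<partial>lborel)"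
    by (rule hardy_poisson[OF hol _ C w]) auto
  also have "\<dots> \<le> (\<integral>\<^sup>+t. ennreal (1 / Im w) * ?u t \<partial>lborel)"
  proof (intro nn_integral_mono mult_right_mono ennreal_leI)
    fix t
    have "Im w / pi / ((Re w - t)\<^sup>2 + (Im w)\<^sup>2) \<le> Im w / 1 / (Im w)\<^sup>2"
      using w pi_gt3 by (intro frac_le) auto
    then show "Im w / pi / ((Re w - t)\<^sup>2 + (Im w)\<^sup>2) \<le> 1 / Im w"
      using w by (simp add: power2_eq_square)
  qed auto
  also have "\<dots> = ennreal (1 / Im w) * (\<integral>\<^sup>+t. ?u t \<partial>lborel)"
    by (rule nn_integral_cmult) measurable
  finally show ?thesis by simp
qed

text \<open>Fatou's lemma for pointwise limits; the passages to the limit in line and boundary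
  integrals go through it.\<close>

lemma nn_integral_le_of_tendsto:
  assumes u: "\<And>n. u n \<in> borel_measurable M" and lim: "\<And>x. (\<lambda>n::nat. u n x) \<longlonglongrightarrow> v x"
    and C: "\<forall>\<^sub>F n in sequentially. (\<integral>\<^sup>+x. u n x \<partial>M) \<le> C"
  shows "(\<integral>\<^sup>+x. v x \<partial>M) \<le> C"
proof -
  have "(\<integral>\<^sup>+x. v x \<partial>M) = (\<integral>\<^sup>+x. liminf (\<lambda>n. u n x) \<partial>M)"
    using lim_imp_Liminf[OF sequentially_bot lim] by simp
  also have "\<dots> \<le> liminf (\<lambda>n. \<integral>\<^sup>+x. u n x \<partial>M)"
    by (rule nn_integral_liminf[OF u])
  also have "\<dots> \<le> C"
    by (rule Liminf_le[OF sequentially_bot C])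
  finally show ?thesis .
qed

text \<open>A witness \<open>C\<close> replaces the supremum over heights. \<open>ennreal\<close>
  sends negative reals to 0, so a negative \<open>C\<close> is legal; the absolute values in the
  estimates below guard against it.\<close>

definition lines_bounded :: "(complex \<Rightarrow> complex) \<Rightarrow> real \<Rightarrow> bool" where
  "lines_bounded f C \<longleftrightarrow> (\<forall>y>0. (\<integral>\<^sup>+x. ennreal ((norm (f (Complex x y)))\<^sup>2) \<partial>lborel) \<le> ennreal C)"

lemma hardy_space2_iff:
  "f \<in> hardy_space2 \<longleftrightarrow> f holomorphic_on {z. Im z > 0} \<and> (\<exists>C. lines_bounded f C)"
proof -
  let ?I = "\<lambda>y. \<integral>\<^sup>+x. ennreal ((norm (f (Complex x y)))\<^sup>2) \<partial>lborel"
  have "(SUP y\<in>{0<..}. ?I y) < \<infinity> \<longleftrightarrow> (\<exists>C. lines_bounded f C)"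
  proof
    assume "(SUP y\<in>{0<..}. ?I y) < \<infinity>"
    then obtain C where C: "(SUP y\<in>{0<..}. ?I y) = ennreal C"
      by (cases "SUP y\<in>{0<..}. ?I y") auto
    have "lines_bounded f C"
      unfolding lines_bounded_def C[symmetric] by (auto intro!: SUP_upper)
    then show "\<exists>C. lines_bounded f C" ..
  next
    assume "\<exists>C. lines_bounded f C"
    then obtain C where "lines_bounded f C" ..
    then have "(SUP y\<in>{0<..}. ?I y) \<le> ennreal C"
      unfolding lines_bounded_def by (auto intro!: SUP_least)
    then show "(SUP y\<in>{0<..}. ?I y) < \<infinity>"
      using order.strict_trans1 ennreal_less_top by fastforce
  qed
  then show ?thesis by (auto simp: hardy_space2_def)
qed

lemma lines_bounded_add:
  assumes [measurable]: "f \<in> borel_measurable borel" "g \<in> borel_measurable borel"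
    and "lines_bounded f A" "lines_bounded g B"
  shows "lines_bounded (\<lambda>z. f z + g z) (2 * \<bar>A\<bar> + 2 * \<bar>B\<bar>)"
  unfolding lines_bounded_def
proof (intro allI impI)
  fix y :: real assume y: "0 < y"
  have "(\<integral>\<^sup>+x. ennreal ((norm (f (Complex x y) + g (Complex x y)))\<^sup>2) \<partial>lborel) \<le>
      (\<integral>\<^sup>+x. ennreal 2 * ennreal ((norm (f (Complex x y)))\<^sup>2) + ennreal 2 * ennreal ((norm (g (Complex x y)))\<^sup>2) \<partial>lborel)"
  proof (intro nn_integral_mono)
    fix x
    let ?a = "norm (f (Complex x y))" and ?b = "norm (g (Complex x y))"
    have "(norm (f (Complex x y) + g (Complex x y)))\<^sup>2 \<le> (?a + ?b)\<^sup>2"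
      by (intro power_mono norm_triangle_ineq) auto
    also have "\<dots> \<le> 2 * ?a\<^sup>2 + 2 * ?b\<^sup>2"
      using zero_le_power2[of "?a - ?b"] by (simp add: power2_sum power2_diff)
    finally have "ennreal ((norm (f (Complex x y) + g (Complex x y)))\<^sup>2) \<le> ennreal (2 * ?a\<^sup>2 + 2 * ?b\<^sup>2)"
      by (rule ennreal_leI)
    also have "\<dots> = ennreal 2 * ennreal (?a\<^sup>2) + ennreal 2 * ennreal (?b\<^sup>2)"
      by (subst ennreal_plus) (simp_all add: ennreal_mult)
    finally show "ennreal ((norm (f (Complex x y) + g (Complex x y)))\<^sup>2) \<le> ennreal 2 * ennreal (?a\<^sup>2) + ennreal 2 * ennreal (?b\<^sup>2)" .
  qed
  also have "\<dots> = ennreal 2 * (\<integral>\<^sup>+x. ennreal ((norm (f (Complex x y)))\<^sup>2) \<partial>lborel)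
       + ennreal 2 * (\<integral>\<^sup>+x. ennreal ((norm (g (Complex x y)))\<^sup>2) \<partial>lborel)"
    by (subst nn_integral_add) (simp_all add: nn_integral_cmult)
  also have "\<dots> \<le> ennreal 2 * ennreal \<bar>A\<bar> + ennreal 2 * ennreal \<bar>B\<bar>"
    using assms(3,4) y unfolding lines_bounded_def
    by (intro add_mono mult_left_mono) (auto intro: order.trans[OF _ ennreal_leI[OF abs_ge_self]])
  also have "\<dots> = ennreal (2 * \<bar>A\<bar> + 2 * \<bar>B\<bar>)"
    by (subst ennreal_plus) (simp_all add: ennreal_mult)
  finally show "(\<integral>\<^sup>+x. ennreal ((norm (f (Complex x y) + g (Complex x y)))\<^sup>2) \<partial>lborel) \<le> \<dots>" .
qed

lemma lines_bounded_cmult: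
  assumes [measurable]: "f \<in> borel_measurable borel" and "lines_bounded f A"
  shows "lines_bounded (\<lambda>z. c * f z) ((norm c)\<^sup>2 * \<bar>A\<bar>)"
  unfolding lines_bounded_def
proof (intro allI impI)
  fix y :: real assume y: "0 < y"
  have "(\<integral>\<^sup>+x. ennreal ((norm (c * f (Complex x y)))\<^sup>2) \<partial>lborel) =
      (\<integral>\<^sup>+x. ennreal ((norm c)\<^sup>2) * ennreal ((norm (f (Complex x y)))\<^sup>2) \<partial>lborel)"
    by (simp add: norm_mult power_mult_distrib ennreal_mult)
  also have "\<dots> = ennreal ((norm c)\<^sup>2) * (\<integral>\<^sup>+x. ennreal ((norm (f (Complex x y)))\<^sup>2) \<partial>lborel)"
    by (rule nn_integral_cmult) measurable
  also have "\<dots> \<le> ennreal ((norm c)\<^sup>2) * ennreal \<bar>A\<bar>"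
    using assms(2) y unfolding lines_bounded_def
    by (intro mult_left_mono) (auto intro: order.trans[OF _ ennreal_leI[OF abs_ge_self]])
  also have "\<dots> = ennreal ((norm c)\<^sup>2 * \<bar>A\<bar>)"
    by (simp add: ennreal_mult)
  finally show "(\<integral>\<^sup>+x. ennreal ((norm (c * f (Complex x y)))\<^sup>2) \<partial>lborel) \<le> \<dots>" .
qed

text \<open>The axis is reached along the heights \<open>1 / (n + 1)\<close>; continuity up to the
  axis gives the pointwise convergence for Fatou's lemma.\<close>

lemma lines_bounded_boundary:
  assumes cont: "continuous_on {z. 0 \<le> Im z} f" and [measurable]: "f \<in> borel_measurable borel"
    and C: "lines_bounded f C"
  shows "(\<integral>\<^sup>+t. ennreal ((norm (f (Complex t 0)))\<^sup>2) \<partial>lborel) \<le> ennreal C"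
proof (rule nn_integral_le_of_tendsto)
  fix t :: real
  have "(\<lambda>n. f (Complex t (1 / Suc n))) \<longlonglongrightarrow> f (Complex t 0)"
  proof (rule continuous_on_tendsto_compose[OF cont])
    have "(\<lambda>n. 1 / real (Suc n)) \<longlonglongrightarrow> 0" using LIMSEQ_Suc lim_1_over_n by blast
    then show "(\<lambda>n. Complex t (1 / Suc n)) \<longlonglongrightarrow> Complex t 0"
      by (intro tendsto_Complex tendsto_const)
  qed auto
  then show "(\<lambda>n. ennreal ((norm (f (Complex t (1 / Suc n))))\<^sup>2)) \<longlonglongrightarrow> ennreal ((norm (f (Complex t 0)))\<^sup>2)"
    by (intro tendsto_intros)
next
  show "\<forall>\<^sub>F n in sequentially. (\<integral>\<^sup>+t. ennreal ((norm (f (Complex t (1 / Suc n))))\<^sup>2) \<partial>lborel) \<le> ennreal C"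
    using C by (auto simp: lines_bounded_def)
qed measurable

section \<open>Entire functions: conjugation, measurability, countability of zeros\<close>

lemma sharp_holomorphic:
  assumes "F holomorphic_on UNIV"
  shows "sharp F holomorphic_on UNIV"
proof -
  have "cnj \<circ> F \<circ> cnj holomorphic_on UNIV"
    by (rule holomorphic_on_compose_cnj_cnj) (use assms holomorphic_on_subset in auto)
  then show ?thesis by (simp add: sharp_def comp_def)
qed

lemma entire_measurable:
  fixes F :: "complex \<Rightarrow> complex"
  assumes "F holomorphic_on UNIV"
  shows "F \<in> borel_measurable borel"
  by (intro borel_measurable_continuous_onI holomorphic_on_imp_continuous_on assms)

lemma entire_countable_zeros:
  assumes "F holomorphic_on UNIV" "F \<noteq> 0"
  shows "countable {z. F z = 0}"
  using holomorphic_countable_equal_UNIV[of F 0] assms by (auto simp: zero_fun_def)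

lemma entire_countable_real_zeros:
  assumes "F holomorphic_on UNIV" "F \<noteq> 0"
  shows "countable {t::real. F (of_real t) = 0}"
proof (rule countable_image_inj_on)
  show "countable (complex_of_real ` {t. F (of_real t) = 0})"
    by (rule countable_subset[OF _ entire_countable_zeros[OF assms]]) auto
qed (simp add: inj_on_def)

section \<open>The inner product of a de Branges space\<close>

locale de_branges =
  fixes E :: "complex \<Rightarrow> complex"
  assumes hb: "hermite_biehler E" and real_nonzero: "\<And>x::real. E (complex_of_real x) \<noteq> 0"
begin

abbreviation "H \<equiv> de_branges_space E"
abbreviation "ip \<equiv> db_inner E"
abbreviation "nrm \<equiv> db_norm E"

text \<open>The norm comes from a Bochner integral, which is 0 for a non-integrable integrand, so
  finiteness is tracked here in \<open>ennreal\<close>; \<open>energy_eq\<close> identifies the two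
  on \<open>H\<close>.\<close>

definition energy :: "(complex \<Rightarrow> complex) \<Rightarrow> ennreal" where
  "energy F = (\<integral>\<^sup>+t. ennreal ((norm (F (of_real t) / E (of_real t)))\<^sup>2) \<partial>lborel)"

lemma E_entire: "E holomorphic_on UNIV"
  using hb by (simp add: hermite_biehler_def)

lemma E_nonzero:
  assumes "0 \<le> Im z" shows "E z \<noteq> 0"
proof (cases "Im z = 0")
  case True
  then have "z = of_real (Re z)" by (simp add: complex_eq_iff)
  then show ?thesis using real_nonzero by metis
next
  case False
  with assms have "norm (sharp E z) < norm (E z)" using hb by (simp add: hermite_biehler_def)
  then show "E z \<noteq> 0" by auto
qed

lemma E_measurable [measurable]: "E \<in> borel_measurable borel"
  by (rule entire_measurable[OF E_entire])

text \<open>Because \<open>E\<close> has no zero on the closed half-plane, boundary values of the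
  quotients are ordinary values.\<close>

lemma quotient_holomorphic:
  assumes "F holomorphic_on UNIV" shows "(\<lambda>z. F z / E z) holomorphic_on {z. 0 \<le> Im z}"
  by (intro holomorphic_intros holomorphic_on_subset[OF assms] holomorphic_on_subset[OF E_entire])
     (auto simp: E_nonzero)

lemma quotient_measurable:
  assumes "F holomorphic_on UNIV" shows "(\<lambda>z. F z / E z) \<in> borel_measurable borel"
  using entire_measurable[OF assms] by measurable

lemma mem_iff:
  "F \<in> H \<longleftrightarrow> F holomorphic_on UNIV \<and> (\<exists>C. lines_bounded (\<lambda>z. F z / E z) C)
     \<and> (\<exists>C. lines_bounded (\<lambda>z. sharp F z / E z) C)"
proof -
  have "(\<lambda>z. G z / E z) holomorphic_on {z. 0 < Im z}" if "G holomorphic_on UNIV" for G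
    by (rule holomorphic_on_subset[OF quotient_holomorphic[OF that]]) auto
  then show ?thesis
    using sharp_holomorphic by (auto simp: de_branges_space_def hardy_space2_iff)
qed

lemma entire: "F \<in> H \<Longrightarrow> F holomorphic_on UNIV"
  by (simp add: mem_iff)

lemma sharp_mem: "F \<in> H \<Longrightarrow> sharp F \<in> H"
  by (auto simp: mem_iff sharp_holomorphic) (auto simp: sharp_def)

lemma add_mem:
  assumes "F \<in> H" "G \<in> H" shows "F + G \<in> H"
proof -
  have 1: "\<exists>C. lines_bounded (\<lambda>z. (A z + B z) / E z) C"
    if "A holomorphic_on UNIV" "B holomorphic_on UNIV" "lines_bounded (\<lambda>z. A z / E z) a"
      "lines_bounded (\<lambda>z. B z / E z) b" for A B a b
    using lines_bounded_add[OF quotient_measurable quotient_measurable that(3,4)] that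
    by (auto simp: add_divide_distrib)
  have "sharp (F + G) = (\<lambda>z. sharp F z + sharp G z)" by (auto simp: sharp_def)
  then show ?thesis
    using assms 1 sharp_holomorphic unfolding mem_iff
    by (simp add: plus_fun_def holomorphic_on_add) meson
qed

lemma cmult_mem:
  assumes "F \<in> H" shows "(\<lambda>z. c * F z) \<in> H"
proof -
  have 1: "\<exists>C. lines_bounded (\<lambda>z. c * A z / E z) C"
    if "A holomorphic_on UNIV" "lines_bounded (\<lambda>z. A z / E z) a" for A a c
    using lines_bounded_cmult[OF quotient_measurable that(2)] that by (auto simp: times_divide_eq_right[symmetric] simp del: times_divide_eq_right)
  have "sharp (\<lambda>z. c * F z) = (\<lambda>z. cnj c * sharp F z)" by (auto simp: sharp_def)
  then show ?thesis
    using assms 1 sharp_holomorphic unfolding mem_iff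
    by (auto intro!: holomorphic_on_mult holomorphic_on_const)
qed

lemma zero_mem: "0 \<in> H"
  by (auto simp: mem_iff sharp_def lines_bounded_def zero_fun_def)

lemma uminus_mem: "F \<in> H \<Longrightarrow> - F \<in> H"
  using cmult_mem[of F "-1"] by (simp add: fun_Compl_def)

lemma diff_mem: "F \<in> H \<Longrightarrow> G \<in> H \<Longrightarrow> F - G \<in> H"
  using add_mem[OF _ uminus_mem, of F G] by simp

lemma energy_Complex: "energy F = (\<integral>\<^sup>+t. ennreal ((norm (F (Complex t 0) / E (Complex t 0)))\<^sup>2) \<partial>lborel)"
  by (simp add: energy_def complex_of_real_def)

lemma energy_finite:
  assumes "F \<in> H" shows "energy F < \<infinity>"
proof -
  obtain C where C: "lines_bounded (\<lambda>z. F z / E z) C" using assms by (auto simp: mem_iff)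
  have "energy F \<le> ennreal C"
    unfolding energy_Complex
    by (rule lines_bounded_boundary[OF _ _ C])
       (use assms entire quotient_holomorphic quotient_measurable holomorphic_on_imp_continuous_on in blast)+
  then show ?thesis using order.strict_trans1 ennreal_less_top by fastforce
qed

lemma continuous_of_real_compose:
  fixes F :: "complex \<Rightarrow> complex"
  assumes "F holomorphic_on UNIV" shows "continuous_on S (\<lambda>t::real. F (of_real t))"
  by (intro continuous_on_compose2[OF holomorphic_on_imp_continuous_on[OF assms]] continuous_intros) auto

lemma measurable_of_real_compose:
  fixes F :: "complex \<Rightarrow> complex"
  assumes "F holomorphic_on UNIV" shows "(\<lambda>t. F (of_real t)) \<in> borel_measurable borel"
  by (intro borel_measurable_continuous_onI continuous_of_real_compose assms)

lemma ip_integrable: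
  assumes "F \<in> H" "G \<in> H"
  shows "integrable lborel (\<lambda>t. F (of_real t) * cnj (G (of_real t)) / of_real ((norm (E (of_real t)))\<^sup>2))"
proof (rule integrableI_bounded)
  note [measurable] = measurable_of_real_compose[OF entire[OF assms(1)]] measurable_of_real_compose[OF entire[OF assms(2)]]
    measurable_of_real_compose[OF E_entire]
  have "continuous_on UNIV (\<lambda>t::real. F (of_real t) * cnj (G (of_real t)) / of_real ((norm (E (of_real t)))\<^sup>2))"
    using assms by (intro continuous_intros continuous_of_real_compose entire E_entire) (simp_all add: real_nonzero)
  then show "(\<lambda>t. F (of_real t) * cnj (G (of_real t)) / of_real ((norm (E (of_real t)))\<^sup>2)) \<in> borel_measurable lborel"
    using borel_measurable_continuous_onI by simp
  have "(\<integral>\<^sup>+t. ennreal (norm (F (of_real t) * cnj (G (of_real t)) / of_real ((norm (E (of_real t)))\<^sup>2))) \<partial>lborel)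
     \<le> (\<integral>\<^sup>+t. ennreal ((norm (F (of_real t) / E (of_real t)))\<^sup>2) + ennreal ((norm (G (of_real t) / E (of_real t)))\<^sup>2) \<partial>lborel)"
  proof (intro nn_integral_mono)
    fix t :: real
    define a b where "a = norm (F (of_real t) / E (of_real t))" and "b = norm (G (of_real t) / E (of_real t))"
    have "0 \<le> a * b" by (simp add: a_def b_def)
    then have "a * b \<le> a\<^sup>2 + b\<^sup>2"
      using zero_le_power2[of "a - b"] by (simp add: power2_diff)
    moreover have "norm (F (of_real t) * cnj (G (of_real t)) / of_real ((norm (E (of_real t)))\<^sup>2)) = a * b"
      by (simp add: a_def b_def norm_mult norm_divide power2_eq_square)
    ultimately have "ennreal (norm (F (of_real t) * cnj (G (of_real t)) / of_real ((norm (E (of_real t)))\<^sup>2)))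
      \<le> ennreal (a\<^sup>2 + b\<^sup>2)"
      by (intro ennreal_leI) simp
    also have "\<dots> = ennreal (a\<^sup>2) + ennreal (b\<^sup>2)" by simp
    finally show "ennreal (norm (F (of_real t) * cnj (G (of_real t)) / of_real ((norm (E (of_real t)))\<^sup>2)))
      \<le> ennreal ((norm (F (of_real t) / E (of_real t)))\<^sup>2) + ennreal ((norm (G (of_real t) / E (of_real t)))\<^sup>2)"
      unfolding a_def b_def .
  qed
  also have "\<dots> = energy F + energy G"
    unfolding energy_def by (rule nn_integral_add) measurable
  also have "\<dots> < \<infinity>" using energy_finite assms by simp
  finally show "(\<integral>\<^sup>+t. ennreal (norm (F (of_real t) * cnj (G (of_real t)) / of_real ((norm (E (of_real t)))\<^sup>2))) \<partial>lborel) < \<infinity>" .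
qed

section \<open>Algebra of the inner product and the norm\<close>

lemma ip_add_left:
  assumes "F \<in> H" "G \<in> H" "K \<in> H" shows "ip (F + G) K = ip F K + ip G K"
  unfolding db_inner_def using ip_integrable assms
  by (subst Bochner_Integration.integral_add[symmetric]) (auto simp: field_simps add_divide_distrib)

lemma ip_cmult_left: "ip (\<lambda>z. c * F z) K = c * ip F K"
  unfolding db_inner_def by (subst integral_mult_right_zero[symmetric]) (simp add: mult_ac)

lemma ip_cnj: "ip G F = cnj (ip F G)"
  unfolding db_inner_def by (subst Bochner_Integration.integral_cnj[symmetric]) (simp add: mult.commute)

lemma ip_cmult_right: "ip K (\<lambda>z. c * F z) = cnj c * ip K F"
  by (subst (1 2) ip_cnj) (simp add: ip_cmult_left)

lemma ip_add_right:
  assumes "F \<in> H" "G \<in> H" "K \<in> H" shows "ip K (F + G) = ip K F + ip K G"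
  by (subst (1 2 3) ip_cnj) (simp add: ip_add_left assms)

lemma ip_uminus_left: "ip (- F) K = - ip F K"
  using ip_cmult_left[of "-1" F K] by (simp add: fun_Compl_def)

lemma ip_uminus_right: "ip K (- F) = - ip K F"
  using ip_cmult_right[of K "-1" F] by (simp add: fun_Compl_def)

lemma ip_diff_left:
  assumes "F \<in> H" "G \<in> H" "K \<in> H" shows "ip (F - G) K = ip F K - ip G K"
  using ip_add_left[of F "- G" K] assms by (simp add: uminus_mem ip_uminus_left)

lemma ip_diff_right:
  assumes "F \<in> H" "G \<in> H" "K \<in> H" shows "ip K (F - G) = ip K F - ip K G"
  using ip_add_right[of F "- G" K] assms by (simp add: uminus_mem ip_uminus_right)

lemma ip_zero: "ip 0 F = 0" "ip F 0 = 0"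
  by (simp_all add: db_inner_def)

lemma ip_self_eq_energy:
  assumes "F \<in> H" shows "ip F F = of_real (enn2real (energy F))"
proof -
  note [measurable] = measurable_of_real_compose[OF entire[OF assms(1)]] measurable_of_real_compose[OF E_entire]
  have "ip F F = (LINT t|lborel. complex_of_real ((norm (F (of_real t) / E (of_real t)))\<^sup>2))"
    unfolding db_inner_def
    by (intro Bochner_Integration.integral_cong)
       (simp_all add: complex_norm_square[symmetric] norm_divide power_divide)
  also have "\<dots> = of_real (LINT t|lborel. (norm (F (of_real t) / E (of_real t)))\<^sup>2)"
    by (rule integral_complex_of_real)
  also have "(LINT t|lborel. (norm (F (of_real t) / E (of_real t)))\<^sup>2) = enn2real (energy F)"
    unfolding energy_def by (rule integral_eq_nn_integral) auto
  finally show ?thesis .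
qed

lemma nrm_nonneg [simp]: "F \<in> H \<Longrightarrow> 0 \<le> nrm F"
  by (simp add: db_norm_def ip_self_eq_energy)

lemma ip_self: "F \<in> H \<Longrightarrow> ip F F = of_real ((nrm F)\<^sup>2)"
  by (simp add: db_norm_def ip_self_eq_energy)

lemma energy_eq: "F \<in> H \<Longrightarrow> energy F = ennreal ((nrm F)\<^sup>2)"
  using energy_finite[of F] by (simp add: db_norm_def ip_self_eq_energy less_top)

text \<open>The norm sees \<open>F\<close> on the real axis up to null sets; a nonzero entire
  function has only countably many real zeros and so cannot vanish almost everywhere there.\<close>

lemma nrm_eq_0:
  assumes F: "F \<in> H" and "nrm F = 0" shows "F = 0"
proof (rule ccontr)
  assume "F \<noteq> 0"
  note [measurable] = measurable_of_real_compose[OF entire[OF F]] measurable_of_real_compose[OF E_entire]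
  have "energy F = 0" using assms by (simp add: energy_eq)
  then have "AE t in lborel. ennreal ((norm (F (of_real t) / E (of_real t)))\<^sup>2) = 0"
    unfolding energy_def by (subst (asm) nn_integral_0_iff_AE) auto
  then have 1: "AE t in lborel. F (of_real t) = 0"
    by eventually_elim (auto simp: real_nonzero)
  have "countable {t::real. F (of_real t) = 0}"
    by (rule entire_countable_real_zeros[OF entire[OF F] \<open>F \<noteq> 0\<close>])
  then have "AE t in lborel. t \<notin> {t::real. F (of_real t) = 0}"
    by (intro AE_not_in countable_imp_null_set_lborel)
  with 1 have "AE t in (lborel :: real measure). False"
    by eventually_elim simp
  then show False by (simp add: AE_iff_null null_sets_def)
qed

text \<open>The single expansion from which Cauchy-Schwarz, the triangle inequality, the
  parallelogram law and the orthogonality of the projection are derived.\<close>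

lemma nrm_sq_add_cmult:
  assumes F: "F \<in> H" and G: "G \<in> H"
  shows "(nrm (F + (\<lambda>z. c * G z)))\<^sup>2 = (nrm F)\<^sup>2 + 2 * Re (cnj c * ip F G) + (norm c)\<^sup>2 * (nrm G)\<^sup>2"
proof -
  let ?K = "\<lambda>z. c * G z"
  have K: "?K \<in> H" by (rule cmult_mem[OF G])
  have "complex_of_real ((nrm (F + ?K))\<^sup>2) = ip (F + ?K) (F + ?K)"
    by (rule ip_self[symmetric]) (rule add_mem[OF F K])
  also have "\<dots> = ip F F + ip F ?K + ip ?K F + ip ?K ?K"
    using F K add_mem by (simp add: ip_add_left ip_add_right)
  also have "\<dots> = of_real ((nrm F)\<^sup>2) + cnj c * ip F G + cnj (cnj c * ip F G) + (c * cnj c) * of_real ((nrm G)\<^sup>2)"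
    using F G by (simp add: ip_cmult_left ip_cmult_right ip_self ip_cnj[of G F])
  also have "c * cnj c = of_real ((norm c)\<^sup>2)" by (rule complex_norm_square[symmetric])
  finally have "complex_of_real ((nrm (F + ?K))\<^sup>2) = of_real ((nrm F)\<^sup>2) + cnj c * ip F G
      + cnj (cnj c * ip F G) + of_real ((norm c)\<^sup>2) * of_real ((nrm G)\<^sup>2)" .
  from arg_cong[OF this, of Re] show ?thesis
    by (simp only: of_real_mult[symmetric] Re_complex_of_real plus_complex.sel cnj.sel mult_2 add.assoc)
qed

lemma cauchy_schwarz:
  assumes F: "F \<in> H" and G: "G \<in> H" shows "norm (ip F G) \<le> nrm F * nrm G"
proof (cases "nrm G = 0")
  case True
  then have "G = 0" using nrm_eq_0 G by blast
  then show ?thesis by (simp add: ip_zero db_norm_def)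
next
  case False
  define s where "s = (nrm G)\<^sup>2"
  have s: "s > 0" using False by (simp add: s_def)
  \<comment> \<open>This \<open>c\<close> minimises the norm of \<open>F + c G\<close>.\<close>
  define c where "c = - ip F G / of_real s"
  have "0 \<le> (nrm F)\<^sup>2 + 2 * Re (cnj c * ip F G) + (norm c)\<^sup>2 * s"
    unfolding s_def nrm_sq_add_cmult[OF F G, symmetric] by simp
  also have "cnj c * ip F G = of_real (- (norm (ip F G))\<^sup>2 / s)"
    using complex_norm_square[of "ip F G"] by (simp add: c_def mult.commute)
  also have "(norm c)\<^sup>2 * s = (norm (ip F G))\<^sup>2 / s"
    using s by (simp add: c_def norm_divide power_divide) (simp add: power2_eq_square)
  finally have "(norm (ip F G))\<^sup>2 / s \<le> (nrm F)\<^sup>2" by simp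
  then have "(norm (ip F G))\<^sup>2 \<le> (nrm F * nrm G)\<^sup>2"
    using s by (simp add: pos_divide_le_eq power_mult_distrib s_def)
  then show ?thesis using F G by (simp add: power2_le_iff_abs_le)
qed

lemma nrm_cmult: "F \<in> H \<Longrightarrow> nrm (\<lambda>z. c * F z) = norm c * nrm F"
proof -
  assume F: "F \<in> H"
  have "(nrm (\<lambda>z. c * F z))\<^sup>2 = (norm c * nrm F)\<^sup>2"
    using nrm_sq_add_cmult[OF zero_mem F, of c] by (simp add: ip_zero power_mult_distrib db_norm_def[of E 0])
  then show ?thesis using F cmult_mem[OF F] by (simp add: power2_eq_iff_nonneg)
qed

lemma nrm_triangle:
  assumes F: "F \<in> H" and G: "G \<in> H" shows "nrm (F + G) \<le> nrm F + nrm G"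
proof (rule power2_le_imp_le)
  have "(nrm (F + G))\<^sup>2 = (nrm F)\<^sup>2 + 2 * Re (ip F G) + (nrm G)\<^sup>2"
    using nrm_sq_add_cmult[OF F G, of 1] by simp
  also have "Re (ip F G) \<le> nrm F * nrm G"
    using cauchy_schwarz[OF F G] complex_Re_le_cmod order.trans by blast
  finally show "(nrm (F + G))\<^sup>2 \<le> (nrm F + nrm G)\<^sup>2" by (simp add: power2_sum)
qed (use F G in simp)

lemma nrm_uminus: "F \<in> H \<Longrightarrow> nrm (- F) = nrm F"
  using nrm_cmult[of F "-1"] by (simp add: fun_Compl_def)

lemma nrm_minus_commute: "F \<in> H \<Longrightarrow> G \<in> H \<Longrightarrow> nrm (F - G) = nrm (G - F)"
  using nrm_uminus[OF diff_mem[of F G]] by simp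

end

section \<open>Point evaluations, completeness and division of zeros\<close>

text \<open>
  On the circle \<open>\<bar>z\<bar> = R\<close> one has \<open>\<bar>z\<^sup>2 - R\<^sup>2\<bar> = 2 R \<bar>Im z\<bar>\<close>, so multiplication by \<open>z\<^sup>2 - R\<^sup>2\<close>
  compensates a blow-up at the real axis.
\<close>

lemma circle_bound:
  assumes hol: "f holomorphic_on UNIV" and r: "0 \<le> r" "r < R"
    and B: "\<And>z. norm z = R \<Longrightarrow> Im z \<noteq> 0 \<Longrightarrow> \<bar>Im z\<bar> * norm (f z) \<le> B"
    and z: "norm z \<le> r"
  shows "norm (f z) \<le> 2 * R * B / (R\<^sup>2 - r\<^sup>2)"
proof -
  have R: "0 < R" using r by simp
  have B0: "0 \<le> B"
    using B[of "\<i> * of_real R"] R by (simp add: norm_mult) (smt (verit) mult_nonneg_nonneg norm_ge_zero)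
  have "norm (f z * (z\<^sup>2 - of_real (R\<^sup>2))) \<le> 2 * R * B"
  proof (rule maximum_modulus_frontier[of "\<lambda>z. f z * (z\<^sup>2 - of_real (R\<^sup>2))" "ball 0 R"])
    show "(\<lambda>z. f z * (z\<^sup>2 - of_real (R\<^sup>2))) holomorphic_on interior (ball 0 R)"
      by (intro holomorphic_intros holomorphic_on_subset[OF hol]) auto
    show "continuous_on (closure (ball 0 R)) (\<lambda>z. f z * (z\<^sup>2 - of_real (R\<^sup>2)))"
      by (intro continuous_intros continuous_on_subset[OF holomorphic_on_imp_continuous_on[OF hol]]) auto
    fix w :: complex assume "w \<in> frontier (ball 0 R)"
    then have w: "norm w = R" using R by (simp add: frontier_ball)
    have "of_real (R\<^sup>2) = w * cnj w" using complex_norm_square[of w] w by simp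
    then have "w\<^sup>2 - of_real (R\<^sup>2) = w * (w - cnj w)" by (simp add: power2_eq_square algebra_simps)
    moreover have "norm (w - cnj w) = 2 * \<bar>Im w\<bar>" by (simp add: complex_diff_cnj norm_mult)
    ultimately have "norm (f w * (w\<^sup>2 - of_real (R\<^sup>2))) = 2 * R * (\<bar>Im w\<bar> * norm (f w))"
      by (simp add: norm_mult w)
    \<comment> \<open>At the two real points of the circle the compensating factor vanishes, so
      there only \<open>0 \<le> B\<close> matters.\<close>
    also have "\<dots> \<le> 2 * R * B"
      using B[OF w] B0 R by (cases "Im w = 0") auto
    finally show "norm (f w * (w\<^sup>2 - of_real (R\<^sup>2))) \<le> 2 * R * B" .
  next
    show "z \<in> ball 0 R" using z r by simp
  qed auto
  moreover have "R\<^sup>2 - r\<^sup>2 \<le> norm (z\<^sup>2 - of_real (R\<^sup>2))"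
  proof -
    have "norm (z\<^sup>2) \<le> r\<^sup>2" unfolding norm_power using z by (intro power_mono) auto
    moreover have "norm (of_real (R\<^sup>2) :: complex) - norm (z\<^sup>2) \<le> norm (of_real (R\<^sup>2) - z\<^sup>2)"
      by (rule norm_triangle_ineq2)
    ultimately show ?thesis by (simp add: norm_minus_commute norm_power)
  qed
  moreover have "0 < R\<^sup>2 - r\<^sup>2" using r by (simp add: power_strict_mono)
  ultimately show ?thesis
    by (simp add: norm_mult pos_le_divide_eq) (meson mult_left_mono norm_ge_zero order.trans)
qed

context de_branges
begin

lemma nrm_sharp: "nrm (sharp F) = nrm F"
  by (simp add: db_norm_def db_inner_def sharp_def mult.commute)

lemma pointwise_upper:
  assumes F: "F \<in> H" and z: "0 < Im z"
  shows "sqrt (Im z) * norm (F z) \<le> norm (E z) * nrm F"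
proof -
  obtain C where C: "lines_bounded (\<lambda>z. F z / E z) C" using F by (auto simp: mem_iff)
  have "ennreal ((norm (F z / E z))\<^sup>2) \<le> ennreal (1 / Im z) *
      (\<integral>\<^sup>+t. ennreal ((norm (F (Complex t 0) / E (Complex t 0)))\<^sup>2) \<partial>lborel)"
    by (rule hardy_pointwise_le[OF quotient_holomorphic quotient_measurable _ z])
       (use C entire[OF F] in \<open>auto simp: lines_bounded_def\<close>)
  also have "\<dots> = ennreal (1 / Im z * (nrm F)\<^sup>2)"
    using z by (subst ennreal_mult) (simp_all add: energy_Complex[symmetric] energy_eq[OF F])
  finally have "(norm (F z / E z))\<^sup>2 \<le> 1 / Im z * (nrm F)\<^sup>2"
    using z by (simp add: ennreal_le_iff)
  then have "(sqrt (Im z) * norm (F z))\<^sup>2 \<le> (norm (E z) * nrm F)\<^sup>2"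
    using z E_nonzero[of z] by (simp add: norm_divide power_mult_distrib power_divide field_simps)
  then show ?thesis using F by (elim power2_le_imp_le) simp
qed

text \<open>In the lower half-plane the estimate is applied to \<open>sharp F\<close>, which has the
  same modulus on the real axis and hence the same norm.\<close>

lemma pointwise_nonreal:
  assumes F: "F \<in> H" and z: "Im z \<noteq> 0"
  shows "sqrt \<bar>Im z\<bar> * norm (F z) \<le> max (norm (E z)) (norm (E (cnj z))) * nrm F"
proof (cases "0 < Im z")
  case True
  then show ?thesis
    using order.trans[OF pointwise_upper[OF F True] mult_right_mono[OF max.cobounded1 nrm_nonneg[OF F]]] by simp
next
  case False
  then have "0 < Im (cnj z)" using z by simp
  from order.trans[OF pointwise_upper[OF sharp_mem[OF F] this, unfolded nrm_sharp] mult_right_mono[OF max.cobounded2 nrm_nonneg[OF F]]]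
  show ?thesis using False by (simp add: sharp_def)
qed

text \<open>The half-plane estimates degenerate at the real axis; the maximum principle in
  \<open>circle_bound\<close> carries them across it. One constant serves a whole disc, so norm
  convergence is locally uniform.\<close>

lemma eval_bound:
  obtains C where "0 \<le> C" "\<And>F (z::complex). F \<in> H \<Longrightarrow> norm z \<le> r \<Longrightarrow> norm (F z) \<le> C * nrm F"
proof -
  define q where "q = max r 0"
  define R where "R = q + 1"
  have q: "0 \<le> q" "q < R" by (auto simp: q_def R_def)
  have "bounded (E ` cball 0 R)"
    by (intro compact_imp_bounded compact_continuous_image compact_cball
        holomorphic_on_imp_continuous_on holomorphic_on_subset[OF E_entire]) auto
  then obtain b where "\<forall>x\<in>E ` cball 0 R. norm x \<le> b"
    unfolding bounded_iff by blast
  then have b: "norm (E z) \<le> b" if "norm z \<le> R" for z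
    using that by simp
  have b0: "0 \<le> b" using order.trans[OF norm_ge_zero b[of 0]] q by simp
  show ?thesis
  proof (rule that[of "2 * R * (sqrt R * b) / (R\<^sup>2 - q\<^sup>2)"])
    have "0 \<le> R\<^sup>2 - q\<^sup>2" using q by (simp add: power_mono)
    then show "0 \<le> 2 * R * (sqrt R * b) / (R\<^sup>2 - q\<^sup>2)" using q b0 by simp
    fix F and z :: complex assume F: "F \<in> H" and z: "norm z \<le> r"
    have "norm (F z) \<le> 2 * R * (sqrt R * (b * nrm F)) / (R\<^sup>2 - q\<^sup>2)"
    proof (rule circle_bound[OF entire[OF F] q])
      fix w assume w: "norm w = R" "Im w \<noteq> 0"
      \<comment> \<open>One square root is absorbed into \<open>sqrt R\<close>; the other is the one
        that \<open>pointwise_nonreal\<close> controls.\<close>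
      have "\<bar>Im w\<bar> * norm (F w) = sqrt \<bar>Im w\<bar> * (sqrt \<bar>Im w\<bar> * norm (F w))"
        by (simp add: mult.assoc[symmetric])
      also have "\<dots> \<le> sqrt R * (b * nrm F)"
      proof (rule mult_mono)
        show "sqrt \<bar>Im w\<bar> \<le> sqrt R" using abs_Im_le_cmod[of w] w by simp
        have "sqrt \<bar>Im w\<bar> * norm (F w) \<le> max (norm (E w)) (norm (E (cnj w))) * nrm F"
          by (rule pointwise_nonreal[OF F w(2)])
        also have "\<dots> \<le> b * nrm F"
          using b[of w] b[of "cnj w"] w F by (intro mult_right_mono) auto
        finally show "sqrt \<bar>Im w\<bar> * norm (F w) \<le> b * nrm F" .
      qed (use q in auto)
      finally show "\<bar>Im w\<bar> * norm (F w) \<le> sqrt R * (b * nrm F)" .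
    next
      show "norm z \<le> q" using z by (simp add: q_def)
    qed
    then show "norm (F z) \<le> 2 * R * (sqrt R * b) / (R\<^sup>2 - q\<^sup>2) * nrm F" by (simp add: mult_ac)
  qed
qed

section \<open>Convergence in norm and completeness\<close>

lemma eval_tendsto:
  assumes F: "\<And>n. F n \<in> H" and G: "G \<in> H" and lim: "(\<lambda>n::nat. nrm (F n - G)) \<longlonglongrightarrow> 0"
  shows "(\<lambda>n. F n z) \<longlonglongrightarrow> G z"
proof -
  obtain C where C: "\<And>F w. F \<in> H \<Longrightarrow> norm w \<le> norm z \<Longrightarrow> norm (F w) \<le> C * nrm F"
    using eval_bound[of "norm z"] by blast
  have "(\<lambda>n. F n z - G z) \<longlonglongrightarrow> 0"
  proof (rule Lim_null_comparison)
    show "(\<lambda>n. C * nrm (F n - G)) \<longlonglongrightarrow> 0" using tendsto_mult_right_zero[OF lim] .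
    show "\<forall>\<^sub>F n in sequentially. norm (F n z - G z) \<le> C * nrm (F n - G)"
      using C[OF diff_mem[OF F G]] by simp
  qed
  then show ?thesis by (rule LIM_zero_cancel)
qed

text \<open>Membership only provides some bound on the lines; here the norm provides one. Bounds
  that depend on the norm alone survive limits.\<close>

lemma lines_bounded_nrm:
  assumes "F \<in> H" shows "lines_bounded (\<lambda>z. F z / E z) ((nrm F)\<^sup>2)"
proof -
  obtain C where C: "lines_bounded (\<lambda>z. F z / E z) C" using assms by (auto simp: mem_iff)
  show ?thesis
    unfolding lines_bounded_def energy_eq[OF assms, symmetric] energy_Complex
    by (intro allI impI hardy_line_integral_le quotient_holomorphic quotient_measurable entire[OF assms])
       (use C in \<open>auto simp: lines_bounded_def\<close>)
qed

lemma borel_measurable_quotient_sq: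
  assumes "F \<in> H" shows "(\<lambda>z. ennreal ((norm (F z / E z))\<^sup>2)) \<in> borel_measurable borel"
proof -
  note [measurable] = quotient_measurable[OF entire[OF assms]]
  show ?thesis by measurable
qed

lemma lines_bounded_limit:
  assumes F: "\<And>n::nat. F n \<in> H" and B: "\<And>n. nrm (F n) \<le> B" and lim: "\<And>z. (\<lambda>n. F n z) \<longlonglongrightarrow> G z"
  shows "lines_bounded (\<lambda>z. G z / E z) (B\<^sup>2)"
  unfolding lines_bounded_def
proof (intro allI impI)
  fix y :: real assume y: "0 < y"
  show "(\<integral>\<^sup>+x. ennreal ((norm (G (Complex x y) / E (Complex x y)))\<^sup>2) \<partial>lborel) \<le> ennreal (B\<^sup>2)"
  proof (rule nn_integral_le_of_tendsto)
    fix x n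
    show "(\<lambda>x. ennreal ((norm (F n (Complex x y) / E (Complex x y)))\<^sup>2)) \<in> borel_measurable lborel" for n
      by (rule measurable_compose[OF _ borel_measurable_quotient_sq[OF F]]) measurable
    show "(\<lambda>n. ennreal ((norm (F n (Complex x y) / E (Complex x y)))\<^sup>2)) \<longlonglongrightarrow>
        ennreal ((norm (G (Complex x y) / E (Complex x y)))\<^sup>2)"
      using y by (intro tendsto_intros lim E_nonzero) auto
    have "(\<integral>\<^sup>+x. ennreal ((norm (F n (Complex x y) / E (Complex x y)))\<^sup>2) \<partial>lborel) \<le> ennreal (B\<^sup>2)" for n
    proof -
      have "(nrm (F n))\<^sup>2 \<le> B\<^sup>2" using B F by (intro power_mono) auto
      then show ?thesis
        using order.trans[OF lines_bounded_nrm[OF F, unfolded lines_bounded_def, rule_format, OF y] ennreal_leI] by blast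
    qed
    then show "\<forall>\<^sub>F n in sequentially. (\<integral>\<^sup>+x. ennreal ((norm (F n (Complex x y) / E (Complex x y)))\<^sup>2) \<partial>lborel) \<le> ennreal (B\<^sup>2)"
      by simp
  qed
qed

lemma nrm_limit_le:
  assumes F: "\<And>n::nat. F n \<in> H" and G: "G \<in> H" and lim: "\<And>z. (\<lambda>n. F n z) \<longlonglongrightarrow> G z"
    and B: "\<forall>\<^sub>F n in sequentially. nrm (F n) \<le> B"
  shows "nrm G \<le> B"
proof -
  have B0: "0 \<le> B"
    using eventually_happens'[OF sequentially_bot B] nrm_nonneg[OF F] order.trans by blast
  have "energy G \<le> ennreal (B\<^sup>2)"
    unfolding energy_def
  proof (rule nn_integral_le_of_tendsto)
    fix t :: real and n
    show "(\<lambda>t. ennreal ((norm (F n (of_real t) / E (of_real t)))\<^sup>2)) \<in> borel_measurable lborel" for n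
      by (rule measurable_compose[OF _ borel_measurable_quotient_sq[OF F]]) measurable
    show "(\<lambda>n. ennreal ((norm (F n (of_real t) / E (of_real t)))\<^sup>2)) \<longlonglongrightarrow>
        ennreal ((norm (G (of_real t) / E (of_real t)))\<^sup>2)"
      by (intro tendsto_intros lim real_nonzero)
    show "\<forall>\<^sub>F n in sequentially. (\<integral>\<^sup>+t. ennreal ((norm (F n (of_real t) / E (of_real t)))\<^sup>2) \<partial>lborel) \<le> ennreal (B\<^sup>2)"
      using B by eventually_elim
        (use F in \<open>auto simp: energy_def[symmetric] energy_eq intro!: ennreal_leI power_mono\<close>)
  qed
  then have "(nrm G)\<^sup>2 \<le> B\<^sup>2" by (simp add: energy_eq[OF G] ennreal_le_iff)
  then show ?thesis using B0 by (rule power2_le_imp_le)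
qed

text \<open>\<open>eval_bound\<close> yields a locally uniform, hence entire, limit. Fatou's lemma
  on each line, applied also to \<open>sharp\<close>, puts it into \<open>H\<close>, and Fatou's
  lemma on the axis gives convergence in norm.\<close>

lemma complete:
  assumes F: "\<And>n::nat. F n \<in> H" and Cau: "\<And>e. 0 < e \<Longrightarrow> \<exists>N. \<forall>m\<ge>N. \<forall>n\<ge>N. nrm (F m - F n) \<le> e"
  obtains G where "G \<in> H" "(\<lambda>n. nrm (F n - G)) \<longlonglongrightarrow> 0"
proof -
  have "\<exists>g. uniform_limit (cball 0 r) F g sequentially" for r :: real
  proof -
    obtain C where C0: "0 \<le> C" and C: "\<And>F z. F \<in> H \<Longrightarrow> norm z \<le> r \<Longrightarrow> norm (F z) \<le> C * nrm F"
      using eval_bound[of r] by blast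
    have "uniformly_Cauchy_on (cball 0 r) F"
      unfolding uniformly_Cauchy_on_def
    proof (intro allI impI)
      fix e :: real assume e: "0 < e"
      \<comment> \<open>\<open>C\<close> may be 0, whence the denominator
        \<open>C + 1\<close>.\<close>
      obtain N where N: "\<And>m n. N \<le> m \<Longrightarrow> N \<le> n \<Longrightarrow> nrm (F m - F n) \<le> e / (C + 1)"
        using Cau[of "e / (C + 1)"] e C0 by auto
      show "\<exists>M. \<forall>x\<in>cball 0 r. \<forall>m\<ge>M. \<forall>n\<ge>M. dist (F m x) (F n x) < e"
      proof (intro exI ballI allI impI)
        fix x :: complex and m n assume x: "x \<in> cball 0 r" and mn: "N \<le> m" "N \<le> n"
        have "dist (F m x) (F n x) \<le> C * nrm (F m - F n)"
          using C[OF diff_mem[OF F F], of x m n] x by (simp add: dist_norm)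
        also have "\<dots> \<le> C * (e / (C + 1))" by (rule mult_left_mono[OF N[OF mn] C0])
        also have "\<dots> < e" using e C0 by (simp add: field_simps)
        finally show "dist (F m x) (F n x) < e" .
      qed
    qed
    then show ?thesis
      using Cauchy_uniformly_convergent unfolding uniformly_convergent_on_def by blast
  qed
  then obtain g where g: "\<And>r. uniform_limit (cball 0 r) F (g r) sequentially" by metis
  \<comment> \<open>The limits on different discs agree where they overlap, so each point may use
    the disc of its own modulus.\<close>
  define G where "G = (\<lambda>z. g (norm z) z)"
  have lim: "(\<lambda>n. F n z) \<longlonglongrightarrow> G z" for z
    unfolding G_def by (rule tendsto_uniform_limitI[OF g]) simp
  have gG: "g r z = G z" if "norm z \<le> r" for r z
    by (rule LIMSEQ_unique[OF tendsto_uniform_limitI[OF g] lim]) (use that in simp)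
  have Gent: "G holomorphic_on UNIV"
  proof (rule holomorphic_uniform_sequence)
    fix z :: complex
    have "uniform_limit (cball z 1) F (g (norm z + 1)) sequentially"
    proof (rule uniform_limit_on_subset[OF g])
      show "cball z 1 \<subseteq> cball 0 (norm z + 1)"
        by (simp add: cball_subset_cball_iff dist_norm)
    qed
    moreover have "g (norm z + 1) w = G w" if "w \<in> cball z 1" for w
      using that norm_triangle_sub[of w z] by (intro gG) (simp add: dist_norm norm_minus_commute)
    ultimately have "uniform_limit (cball z 1) F G sequentially"
      by (simp add: uniform_limit_iff)
    then show "\<exists>d>0. cball z d \<subseteq> UNIV \<and> uniform_limit (cball z d) F G sequentially"
      by (intro exI[of _ 1]) auto
  qed (use F entire in auto)
  \<comment> \<open>Dropping the first \<open>N\<close> terms gives one norm bound for all the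
    remaining ones.\<close>
  obtain N where N: "\<And>m. N \<le> m \<Longrightarrow> nrm (F m - F N) \<le> 1"
    using Cau[of 1] by auto
  define B where "B = nrm (F N) + 1"
  have B: "nrm (F (n + N)) \<le> B" for n
  proof -
    have "nrm (F N + (F (n + N) - F N)) \<le> nrm (F N) + nrm (F (n + N) - F N)"
      by (rule nrm_triangle[OF F diff_mem[OF F F]])
    then show ?thesis using N[of "n + N"] by (simp add: B_def)
  qed
  have lim': "(\<lambda>n. F (n + N) z) \<longlonglongrightarrow> G z" for z
    using LIMSEQ_ignore_initial_segment[OF lim] .
  have "lines_bounded (\<lambda>z. G z / E z) (B\<^sup>2)"
    by (rule lines_bounded_limit[OF F B lim'])
  moreover have "lines_bounded (\<lambda>z. sharp G z / E z) (B\<^sup>2)"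
  proof (rule lines_bounded_limit[OF sharp_mem[OF F]])
    show "nrm (sharp (F (n + N))) \<le> B" for n using B by (simp add: nrm_sharp)
    show "(\<lambda>n. sharp (F (n + N)) z) \<longlonglongrightarrow> sharp G z" for z
      unfolding sharp_def by (intro tendsto_intros lim')
  qed
  ultimately have G: "G \<in> H" using Gent by (auto simp: mem_iff)
  have "(\<lambda>n. nrm (F n - G)) \<longlonglongrightarrow> 0"
  proof (rule LIMSEQ_I)
    fix e :: real assume e: "0 < e"
    obtain N where N: "\<And>m n. N \<le> m \<Longrightarrow> N \<le> n \<Longrightarrow> nrm (F m - F n) \<le> e / 2"
      using Cau[of "e / 2"] e by auto
    have "nrm (F n - G) \<le> e / 2" if n: "N \<le> n" for n
    proof (rule nrm_limit_le)
      show "F n - F m \<in> H" "F n - G \<in> H" for m using F G diff_mem by auto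
      show "(\<lambda>m. (F n - F m) z) \<longlonglongrightarrow> (F n - G) z" for z
        by (simp, intro tendsto_intros lim)
      show "\<forall>\<^sub>F m in sequentially. nrm (F n - F m) \<le> e / 2"
        using N[OF n] unfolding eventually_sequentially by blast
    qed
    then show "\<exists>N. \<forall>n\<ge>N. norm (nrm (F n - G) - 0) < e"
      using e F G diff_mem by (intro exI[of _ N]) force
  qed
  with G show ?thesis by (rule that)
qed

text \<open>Off the unit disc about \<open>w\<close> the factor \<open>z - w\<close> has modulus at
  least 1. Inside, \<open>G / E\<close> is bounded by compactness on the part in the closed
  half-plane, and a horizontal line meets the disc in an interval of length at most 2.\<close>

lemma lines_bounded_divide:
  assumes G: "G holomorphic_on UNIV" and C: "lines_bounded (\<lambda>z. (z - w) * G z / E z) C"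
  shows "\<exists>C. lines_bounded (\<lambda>z. G z / E z) C"
proof -
  define f where "f = (\<lambda>z. G z / E z)"
  have [measurable]: "f \<in> borel_measurable borel" unfolding f_def by (rule quotient_measurable[OF G])
  have "bounded (f ` (cball w 1 \<inter> {z. 0 \<le> Im z}))"
    unfolding f_def
    by (intro compact_imp_bounded compact_continuous_image compact_Int_closed compact_cball closed_halfspace_Im_ge
        holomorphic_on_imp_continuous_on holomorphic_on_subset[OF quotient_holomorphic[OF G]]) auto
  then obtain M where "\<forall>x\<in>f ` (cball w 1 \<inter> {z. 0 \<le> Im z}). norm x \<le> M"
    unfolding bounded_iff by blast
  then have M: "norm (f z) \<le> M" if "dist w z \<le> 1" "0 \<le> Im z" for z
    using that by simp
  have le: "ennreal ((norm (f (Complex x y)))\<^sup>2) \<le> ennreal ((norm ((Complex x y - w) * f (Complex x y)))\<^sup>2)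
      + ennreal (M\<^sup>2) * indicator {Re w - 1..Re w + 1} x" if "0 < y" for x y
  proof (cases "dist w (Complex x y) \<le> 1")
    case True
    then have "(norm (f (Complex x y)))\<^sup>2 \<le> M\<^sup>2" using that M[OF True] by (intro power_mono) auto
    moreover have "x \<in> {Re w - 1..Re w + 1}"
      using abs_Re_le_cmod[of "w - Complex x y"] True by (auto simp: dist_norm)
    ultimately show ?thesis by (simp add: add_increasing ennreal_leI)
  next
    case False
    then have "1 * norm (f (Complex x y)) \<le> norm (Complex x y - w) * norm (f (Complex x y))"
      by (intro mult_right_mono) (auto simp: dist_norm norm_minus_commute)
    then have "(norm (f (Complex x y)))\<^sup>2 \<le> (norm ((Complex x y - w) * f (Complex x y)))\<^sup>2"
      by (intro power_mono) (auto simp: norm_mult)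
    then show ?thesis by (intro add_increasing2 ennreal_leI) auto
  qed
  have "lines_bounded f (\<bar>C\<bar> + M\<^sup>2 * 2)"
    unfolding lines_bounded_def
  proof (intro allI impI)
    fix y :: real assume y: "0 < y"
    have "(\<integral>\<^sup>+x. ennreal ((norm (f (Complex x y)))\<^sup>2) \<partial>lborel) \<le>
       (\<integral>\<^sup>+x. ennreal ((norm ((Complex x y - w) * f (Complex x y)))\<^sup>2) + ennreal (M\<^sup>2) * indicator {Re w - 1..Re w + 1} x \<partial>lborel)"
      by (intro nn_integral_mono le y)
    also have "\<dots> = (\<integral>\<^sup>+x. ennreal ((norm ((Complex x y - w) * f (Complex x y)))\<^sup>2) \<partial>lborel) +
        (\<integral>\<^sup>+x. ennreal (M\<^sup>2) * indicator {Re w - 1..Re w + 1} x \<partial>lborel)"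
      by (rule nn_integral_add) measurable
    also have "(\<integral>\<^sup>+x. ennreal (M\<^sup>2) * indicator {Re w - 1..Re w + 1} x \<partial>lborel) = ennreal (M\<^sup>2 * 2)"
      by (subst nn_integral_cmult_indicator) (auto simp: ennreal_mult)
    also have "(\<integral>\<^sup>+x. ennreal ((norm ((Complex x y - w) * f (Complex x y)))\<^sup>2) \<partial>lborel) \<le> ennreal \<bar>C\<bar>"
      using order.trans[OF C[unfolded lines_bounded_def, rule_format, OF y] ennreal_leI[OF abs_ge_self]] by (simp add: f_def)
    finally show "(\<integral>\<^sup>+x. ennreal ((norm (f (Complex x y)))\<^sup>2) \<partial>lborel) \<le> ennreal (\<bar>C\<bar> + M\<^sup>2 * 2)"
      by (simp add: add_mono)
  qed
  then show ?thesis unfolding f_def ..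
qed

lemma divide_mem:
  assumes G: "G holomorphic_on UNIV" and "(\<lambda>z. (z - w) * G z) \<in> H" shows "G \<in> H"
proof -
  have "sharp (\<lambda>z. (z - w) * G z) = (\<lambda>z. (z - cnj w) * sharp G z)" by (simp add: sharp_def)
  then obtain A B where "lines_bounded (\<lambda>z. (z - w) * G z / E z) A"
      "lines_bounded (\<lambda>z. (z - cnj w) * sharp G z / E z) B"
    using assms(2) unfolding mem_iff by auto
  then show ?thesis
    using G lines_bounded_divide[OF G] lines_bounded_divide[OF sharp_holomorphic[OF G]]
    unfolding mem_iff by blast
qed

end

section \<open>Orthogonal projections and reproducing kernels\<close>

context de_branges
begin

text \<open>\<open>nrm\<close> is a norm only on the set \<open>H\<close>, so closedness is
  expressed by sequences, with the limit taken in \<open>H\<close>.\<close>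

definition closed_subspace :: "(complex \<Rightarrow> complex) set \<Rightarrow> bool" where
  "closed_subspace N \<longleftrightarrow> N \<subseteq> H \<and> 0 \<in> N \<and> (\<forall>F\<in>N. \<forall>G\<in>N. F + G \<in> N) \<and> (\<forall>c. \<forall>F\<in>N. (\<lambda>z. c * F z) \<in> N)
     \<and> (\<forall>F G. (\<forall>n::nat. F n \<in> N) \<longrightarrow> G \<in> H \<longrightarrow> (\<lambda>n. nrm (F n - G)) \<longlonglongrightarrow> 0 \<longrightarrow> G \<in> N)"

lemma closed_subspaceD:
  assumes "closed_subspace N"
  shows "N \<subseteq> H" "0 \<in> N" "F \<in> N \<Longrightarrow> G \<in> N \<Longrightarrow> F + G \<in> N" "F \<in> N \<Longrightarrow> (\<lambda>z. c * F z) \<in> N"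
    "(\<And>n::nat. K n \<in> N) \<Longrightarrow> G \<in> H \<Longrightarrow> (\<lambda>n. nrm (K n - G)) \<longlonglongrightarrow> 0 \<Longrightarrow> G \<in> N"
  using assms unfolding closed_subspace_def by blast+

lemma closed_subspace_diff:
  assumes "closed_subspace N" "F \<in> N" "G \<in> N" shows "F - G \<in> N"
  using closed_subspaceD(3)[OF assms(1,2) closed_subspaceD(4)[OF assms(1,3), of "-1"]]
  by (simp add: fun_diff_def plus_fun_def)

lemma parallelogram:
  assumes F: "F \<in> H" and G: "G \<in> H"
  shows "(nrm (F - G))\<^sup>2 = 2 * (nrm F)\<^sup>2 + 2 * (nrm G)\<^sup>2 - (nrm (F + G))\<^sup>2"
proof -
  have eq: "F - G = F + (\<lambda>z. -1 * G z)" by (simp add: fun_diff_def plus_fun_def)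
  have "(nrm (F - G))\<^sup>2 = (nrm F)\<^sup>2 - 2 * Re (ip F G) + (nrm G)\<^sup>2"
    unfolding eq nrm_sq_add_cmult[OF F G] by simp
  moreover have "(nrm (F + G))\<^sup>2 = (nrm F)\<^sup>2 + 2 * Re (ip F G) + (nrm G)\<^sup>2"
    using nrm_sq_add_cmult[OF F G, of 1] by simp
  ultimately show ?thesis by simp
qed

text \<open>By the parallelogram law a minimising sequence is Cauchy, and \<open>complete\<close>
  provides its limit.\<close>

lemma nearest_point:
  assumes N: "closed_subspace N" and F: "F \<in> H"
  obtains P where "P \<in> N" "\<And>G. G \<in> N \<Longrightarrow> nrm (F - P) \<le> nrm (F - G)"
proof -
  note NH = subsetD[OF closed_subspaceD(1)[OF N]]
  define d where "d = (INF G\<in>N. (nrm (F - G))\<^sup>2)"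
  have bdd: "bdd_below ((\<lambda>G. (nrm (F - G))\<^sup>2) ` N)" by (intro bdd_belowI2[of _ 0]) simp
  have d_le: "d \<le> (nrm (F - G))\<^sup>2" if "G \<in> N" for G
    unfolding d_def by (rule cINF_lower[OF bdd that])
  have "\<exists>G\<in>N. (nrm (F - G))\<^sup>2 < d + 1 / real (Suc n)" for n
  proof -
    have "(INF G\<in>N. (nrm (F - G))\<^sup>2) < d + 1 / real (Suc n)" by (simp add: d_def)
    then show ?thesis
      using cINF_less_iff[OF _ bdd] closed_subspaceD(2)[OF N] by blast
  qed
  then obtain G where GN: "\<And>n. G n \<in> N" and Gd: "\<And>n. (nrm (F - G n))\<^sup>2 < d + 1 / real (Suc n)"
    by metis
  note GH = NH[OF GN]
  have close: "(nrm (G m - G n))\<^sup>2 \<le> 2 / real (Suc m) + 2 / real (Suc n)" for m n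
  proof -
    \<comment> \<open>The midpoint lies in \<open>N\<close>, so its squared distance from
      \<open>F\<close> is at least \<open>d\<close>; this controls the subtracted term of the
      parallelogram law.\<close>
    define Q where "Q = (\<lambda>z. (1/2) * (G n + G m) z)"
    have Q: "Q \<in> N" unfolding Q_def
      by (intro closed_subspaceD(4)[OF N] closed_subspaceD(3)[OF N] GN)
    have eq: "(F - G n) + (F - G m) = (\<lambda>z. 2 * (F - Q) z)"
      by (auto simp: Q_def fun_eq_iff algebra_simps)
    have eq2: "(F - G n) - (F - G m) = G m - G n" by (simp add: algebra_simps)
    have "(nrm (G m - G n))\<^sup>2 = 2 * (nrm (F - G n))\<^sup>2 + 2 * (nrm (F - G m))\<^sup>2 - 4 * (nrm (F - Q))\<^sup>2"
      using parallelogram[OF diff_mem[OF F GH] diff_mem[OF F GH], of n m] diff_mem[OF F NH[OF Q]]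
      unfolding eq eq2 nrm_cmult[OF diff_mem[OF F NH[OF Q]]] by (simp add: power_mult_distrib)
    then show ?thesis using Gd[of n] Gd[of m] d_le[OF Q] by simp
  qed
  obtain P where P: "P \<in> H" and lim: "(\<lambda>n. nrm (G n - P)) \<longlonglongrightarrow> 0"
  proof (rule complete[OF GH])
    fix e :: real assume e: "0 < e"
    obtain M where M: "4 / e\<^sup>2 < real M" using reals_Archimedean2 by blast
    have small: "2 / real (Suc n) \<le> e\<^sup>2 / 2" if "M \<le> n" for n
    proof -
      have "4 / e\<^sup>2 \<le> real (Suc n)" using M that by linarith
      then show ?thesis using e by (simp add: field_simps)
    qed
    show "\<exists>N. \<forall>m\<ge>N. \<forall>n\<ge>N. nrm (G m - G n) \<le> e"
    proof (intro exI[of _ M] allI impI)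
      fix m n assume "M \<le> m" "M \<le> n"
      then have "(nrm (G m - G n))\<^sup>2 \<le> e\<^sup>2" using close[of m n] small[of m] small[of n] by linarith
      then show "nrm (G m - G n) \<le> e" by (rule power2_le_imp_le) (use e in simp)
    qed
  qed
  have PN: "P \<in> N" by (rule closed_subspaceD(5)[OF N GN P lim])
  show ?thesis
  proof (rule that[OF PN])
    fix K assume K: "K \<in> N"
    have "(\<lambda>n. nrm (G n - P)) \<longlonglongrightarrow> 0" by (rule lim)
    moreover have "(\<lambda>n. sqrt (d + 1 / real (Suc n))) \<longlonglongrightarrow> sqrt (d + 0)"
      using LIMSEQ_Suc[OF lim_1_over_n] by (intro tendsto_intros)
    ultimately have "(\<lambda>n. sqrt (d + 1 / real (Suc n)) + nrm (G n - P)) \<longlonglongrightarrow> sqrt (d + 0) + 0"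
      by (intro tendsto_add)
    then have "nrm (F - P) \<le> sqrt (d + 0) + 0"
    proof (rule LIMSEQ_le_const, intro exI allI impI)
      fix n
      have "nrm (F - P) = nrm ((F - G n) + (G n - P))" by (simp add: algebra_simps)
      also have "\<dots> \<le> nrm (F - G n) + nrm (G n - P)"
        by (intro nrm_triangle diff_mem F GH P)
      also have "\<dots> \<le> sqrt (d + 1 / real (Suc n)) + nrm (G n - P)"
        by (intro add_right_mono real_le_rsqrt less_imp_le Gd)
      finally show "nrm (F - P) \<le> sqrt (d + 1 / real (Suc n)) + nrm (G n - P)" .
    qed
    also have "sqrt (d + 0) + 0 \<le> nrm (F - K)"
      using d_le[OF K] diff_mem[OF F NH[OF K]] by (simp add: real_le_lsqrt)
    finally show "nrm (F - P) \<le> nrm (F - K)" .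
  qed
qed

lemma projection:
  assumes N: "closed_subspace N" and F: "F \<in> H"
  obtains P where "P \<in> N" "\<And>G. G \<in> N \<Longrightarrow> ip (F - P) G = 0"
proof -
  note NH = subsetD[OF closed_subspaceD(1)[OF N]]
  obtain P where P: "P \<in> N" and min: "\<And>G. G \<in> N \<Longrightarrow> nrm (F - P) \<le> nrm (F - G)"
    using nearest_point[OF N F] by blast
  define A where "A = F - P"
  have A: "A \<in> H" unfolding A_def by (intro diff_mem F NH P)
  have "ip A G = 0" if G: "G \<in> N" for G
  proof (rule ccontr)
    define q where "q = ip A G"
    assume "ip A G \<noteq> 0"
    then have q: "0 < (norm q)\<^sup>2" by (simp add: q_def)
    \<comment> \<open>A small step from \<open>F - P\<close> against its component along
      \<open>G\<close> would shorten it. This \<open>s\<close> gives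
      \<open>s * (nrm G)\<^sup>2 \<le> 1\<close>, below the 2 of the linear term; the
      \<open>+ 1\<close> keeps the denominator positive.\<close>
    define s where "s = 1 / ((nrm G)\<^sup>2 + 1)"
    have pos: "0 < (nrm G)\<^sup>2 + 1" by (simp add: add_nonneg_pos)
    have s: "0 < s" using pos by (simp add: s_def)
    define c where "c = - of_real s * q"
    have eq: "A + (\<lambda>z. c * G z) = F - (P + (\<lambda>z. (-c) * G z))"
      by (auto simp: A_def fun_eq_iff)
    have "nrm A \<le> nrm (A + (\<lambda>z. c * G z))"
      unfolding eq by (unfold A_def, intro min closed_subspaceD(3,4)[OF N] P G)
    then have "(nrm A)\<^sup>2 \<le> (nrm (A + (\<lambda>z. c * G z)))\<^sup>2"
      using A by (intro power_mono) auto
    also have "\<dots> = (nrm A)\<^sup>2 + 2 * Re (cnj c * ip A G) + (norm c)\<^sup>2 * (nrm G)\<^sup>2"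
      by (rule nrm_sq_add_cmult[OF A NH[OF G]])
    also have "cnj c * ip A G = of_real (- s * (norm q)\<^sup>2)"
      using complex_norm_square[of q] by (simp add: c_def q_def mult.commute)
    also have "(norm c)\<^sup>2 = s\<^sup>2 * (norm q)\<^sup>2"
      by (simp add: c_def norm_mult power_mult_distrib)
    finally have "0 \<le> - 2 * s * (norm q)\<^sup>2 + s\<^sup>2 * (norm q)\<^sup>2 * (nrm G)\<^sup>2" by simp
    also have "\<dots> = s * (norm q)\<^sup>2 * (s * (nrm G)\<^sup>2 - 2)"
      by (simp add: algebra_simps power2_eq_square)
    finally have "0 \<le> s * (nrm G)\<^sup>2 - 2"
      using mult_pos_pos[OF s q] by (simp only: zero_le_mult_iff) linarith
    moreover have "s * (nrm G)\<^sup>2 \<le> 1" using pos by (simp add: s_def)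
    ultimately show False by simp
  qed
  then show ?thesis using that[OF P] by (simp add: A_def)
qed

lemma eq_zero_if_orthogonal_self: "F \<in> H \<Longrightarrow> ip F F = 0 \<Longrightarrow> F = 0"
  using nrm_eq_0 by (auto simp: ip_self)

text \<open>Relative to a closed subspace, because point evaluations and derivatives must be
  represented inside the annihilator. \<open>D\<close> is orthogonal to the null space of
  \<open>\<phi>\<close> and spans its complement in \<open>M\<close>.\<close>

lemma riesz:
  assumes M: "closed_subspace M"
    and add: "\<And>F G. F \<in> M \<Longrightarrow> G \<in> M \<Longrightarrow> \<phi> (F + G) = \<phi> F + \<phi> G"
    and cmult: "\<And>c F. F \<in> M \<Longrightarrow> \<phi> (\<lambda>z. c * F z) = c * \<phi> F"
    and bound: "\<And>F. F \<in> M \<Longrightarrow> norm (\<phi> F) \<le> C * nrm F"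
  obtains K where "K \<in> M" "\<And>F. F \<in> M \<Longrightarrow> ip F K = \<phi> F"
proof (cases "\<forall>F\<in>M. \<phi> F = 0")
  case True
  then show ?thesis using that[of 0] closed_subspaceD(2)[OF M] by (simp add: ip_zero)
next
  case False
  note MH = subsetD[OF closed_subspaceD(1)[OF M]]
  have diff: "\<phi> (F - G) = \<phi> F - \<phi> G" if "F \<in> M" "G \<in> M" for F G
  proof -
    have eq: "F - G = F + (\<lambda>z. -1 * G z)" by (simp add: fun_diff_def plus_fun_def)
    show ?thesis
      unfolding eq add[OF that(1) closed_subspaceD(4)[OF M that(2)]] cmult[OF that(2)] by simp
  qed
  define N where "N = {F \<in> M. \<phi> F = 0}"
  have "closed_subspace N"
    unfolding closed_subspace_def
  proof (intro conjI allI impI ballI)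
    show "N \<subseteq> H" using MH by (auto simp: N_def)
    have "\<phi> 0 = 0" using cmult[OF closed_subspaceD(2)[OF M], of 0] by (simp add: zero_fun_def)
    then show "0 \<in> N" using closed_subspaceD(2)[OF M] by (simp add: N_def)
    show "F + G \<in> N" if "F \<in> N" "G \<in> N" for F G
      using that add closed_subspaceD(3)[OF M] by (auto simp: N_def)
    show "(\<lambda>z. c * F z) \<in> N" if "F \<in> N" for F c
      using that cmult closed_subspaceD(4)[OF M] by (auto simp: N_def)
    fix K G assume K: "\<forall>n::nat. K n \<in> N" and G: "G \<in> H" and lim: "(\<lambda>n. nrm (K n - G)) \<longlonglongrightarrow> 0"
    have GM: "G \<in> M" using closed_subspaceD(5)[OF M _ G lim] K by (simp add: N_def)
    have "norm (\<phi> G) \<le> C * nrm (K n - G)" for n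
      using bound[OF closed_subspace_diff[OF M _ GM], of "K n"] diff[OF _ GM, of "K n"] K by (simp add: N_def)
    moreover have "(\<lambda>n. C * nrm (K n - G)) \<longlonglongrightarrow> 0" using tendsto_mult_right_zero[OF lim] .
    ultimately have "norm (\<phi> G) \<le> 0" by (intro LIMSEQ_le_const) auto
    then show "G \<in> N" using GM by (simp add: N_def)
  qed
  moreover obtain F0 where F0: "F0 \<in> M" "\<phi> F0 \<noteq> 0" using False by blast
  ultimately obtain P where P: "P \<in> N" and orth: "\<And>G. G \<in> N \<Longrightarrow> ip (F0 - P) G = 0"
    using projection MH by metis
  define D where "D = F0 - P"
  have DM: "D \<in> M" unfolding D_def using closed_subspace_diff[OF M F0(1)] P by (simp add: N_def)
  have \<phi>D: "\<phi> D \<noteq> 0" unfolding D_def using diff[OF F0(1)] P F0 by (simp add: N_def)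
  have "D \<noteq> 0"
  proof
    assume "D = 0"
    then show False using \<phi>D cmult[OF DM, of 0] by (simp add: zero_fun_def)
  qed
  then have D2: "ip D D \<noteq> 0" using eq_zero_if_orthogonal_self[OF MH[OF DM]] by blast
  \<comment> \<open>\<open>F\<close> differs from a multiple of \<open>D\<close> by an element of
    the null space, to which \<open>D\<close> is orthogonal.\<close>
  have ipD: "ip F D = \<phi> F / \<phi> D * ip D D" if F: "F \<in> M" for F
  proof -
    define L where "L = (\<lambda>z. (\<phi> F / \<phi> D) * D z)"
    have L: "L \<in> M" unfolding L_def by (rule closed_subspaceD(4)[OF M DM])
    have "F - L \<in> N"
      using closed_subspace_diff[OF M F L] diff[OF F L] cmult[OF DM, of "\<phi> F / \<phi> D"] \<phi>D
      by (simp add: N_def L_def)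
    then have "ip (F - L) D = 0" using orth[of "F - L"] ip_cnj[of "F - L" D] by (simp add: D_def)
    then have "ip F D = ip L D" using ip_diff_left[OF MH[OF F] MH[OF L] MH[OF DM]] by simp
    then show ?thesis unfolding L_def ip_cmult_left .
  qed
  \<comment> \<open>The conjugate compensates for \<open>ip\<close> being conjugate linear in its
    second argument.\<close>
  define c where "c = cnj (\<phi> D / ip D D)"
  show ?thesis
  proof (rule that)
    show "(\<lambda>z. c * D z) \<in> M" by (rule closed_subspaceD(4)[OF M DM])
    show "ip F (\<lambda>z. c * D z) = \<phi> F" if "F \<in> M" for F
      unfolding ip_cmult_right ipD[OF that] using \<phi>D D2 by (simp add: c_def)
  qed
qed

lemma closed_subspace_zeros: "closed_subspace {F \<in> H. \<forall>z\<in>Z. F z = 0}"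
  unfolding closed_subspace_def
proof (intro conjI allI impI ballI)
  fix K G assume K: "\<forall>n::nat. K n \<in> {F \<in> H. \<forall>z\<in>Z. F z = 0}" and G: "G \<in> H" and lim: "(\<lambda>n. nrm (K n - G)) \<longlonglongrightarrow> 0"
  have "G z = 0" if "z \<in> Z" for z
    using eval_tendsto[OF _ G lim, of z] K that LIMSEQ_unique[OF _ tendsto_const[of 0]] by simp
  then show "G \<in> {F \<in> H. \<forall>z\<in>Z. F z = 0}" using G by simp
qed (auto intro: zero_mem add_mem cmult_mem)

lemma closed_subspace_H: "closed_subspace H"
  using closed_subspace_zeros[of "{}"] by simp

text \<open>Discharges the definite description: existence is the Riesz representation of a bounded
  evaluation, uniqueness the definiteness of the norm.\<close>

lemma kernel:
  shows kernel_mem: "reproducing_kernel E w \<in> H"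
    and kernel_reproduces: "F \<in> H \<Longrightarrow> ip F (reproducing_kernel E w) = F w"
proof -
  obtain C where C: "\<And>F. F \<in> H \<Longrightarrow> norm (F w) \<le> C * nrm F"
    using eval_bound[of "norm w"] by (metis order_refl)
  obtain K where K: "K \<in> H" "\<And>F. F \<in> H \<Longrightarrow> ip F K = F w"
    by (rule riesz[OF closed_subspace_H, of "\<lambda>F. F w" C]) (use C in auto)
  have uniq: "K' = K" if "K' \<in> H" "\<forall>F\<in>H. ip F K' = F w" for K'
  proof -
    have D: "K' - K \<in> H" by (rule diff_mem[OF that(1) K(1)])
    have "ip (K' - K) (K' - K) = 0"
      using that K D by (simp add: ip_diff_right)
    then show ?thesis using eq_zero_if_orthogonal_self[OF D] by simp
  qed
  have "reproducing_kernel E w \<in> H \<and> (\<forall>F\<in>H. ip F (reproducing_kernel E w) = F w)"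
    unfolding reproducing_kernel_def
  proof (rule theI[of "\<lambda>k. k \<in> H \<and> (\<forall>F\<in>H. ip F k = F w)" K])
    show "K \<in> H \<and> (\<forall>F\<in>H. ip F K = F w)" using K by blast
    show "K' = K" if "K' \<in> H \<and> (\<forall>F\<in>H. ip F K' = F w)" for K' using uniq that by blast
  qed
  then show "reproducing_kernel E w \<in> H" "F \<in> H \<Longrightarrow> ip F (reproducing_kernel E w) = F w" by blast+
qed

abbreviation "kern \<equiv> reproducing_kernel E"

section \<open>Closed spans of kernels and functions vanishing on a set\<close>

lemma span_kernels:
  assumes "F \<in> cfun.span (kern ` \<Lambda>)"
  shows "F \<in> H \<and> (\<forall>G\<in>H. (\<forall>\<mu>\<in>\<Lambda>. G \<mu> = 0) \<longrightarrow> ip G F = 0)"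
  using assms
proof (induction rule: cfun.span_induct_alt)
  case base
  have "(\<lambda>z. 0) = (0 :: complex \<Rightarrow> complex)" by (simp add: zero_fun_def)
  then show ?case using zero_mem ip_zero by metis
next
  case (step c x y)
  then obtain \<mu> where \<mu>: "\<mu> \<in> \<Lambda>" "x = kern \<mu>" by auto
  have x: "(\<lambda>z. c * x z) \<in> H" using cmult_mem kernel_mem \<mu> by blast
  have "ip G ((\<lambda>z. c * x z) + y) = 0" if "G \<in> H" "\<forall>\<mu>\<in>\<Lambda>. G \<mu> = 0" for G
    using that step.IH \<mu> x kernel_reproduces[OF that(1)] by (simp add: ip_add_right ip_cmult_right)
  then show ?case using step.IH x add_mem by blast
qed

lemma nrm_zero: "nrm 0 = 0"
  by (simp add: db_norm_def ip_zero)

text \<open>\<open>closed_span\<close> is defined by approximation within every positive error;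
  projecting onto it requires closedness in the sequential sense.\<close>

lemma closed_subspace_closed_span: "closed_subspace (closed_span E kern \<Lambda>)"
  unfolding closed_subspace_def
proof (intro conjI allI impI ballI)
  let ?S = "cfun.span (kern ` \<Lambda>)"
  show "closed_span E kern \<Lambda> \<subseteq> H" by (auto simp: closed_span_def)
  show "0 \<in> closed_span E kern \<Lambda>"
    unfolding closed_span_def
  proof (intro CollectI conjI zero_mem allI impI)
    show "\<exists>G\<in>?S. nrm (0 - G) < \<epsilon>" if "\<epsilon> > 0" for \<epsilon>
      by (rule bexI[OF _ cfun.span_zero]) (use that in \<open>simp add: nrm_zero\<close>)
  qed
next
  fix F G assume FG: "F \<in> closed_span E kern \<Lambda>" "G \<in> closed_span E kern \<Lambda>"
  note SH = span_kernels[THEN conjunct1]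
  have H: "F \<in> H" "G \<in> H" using FG by (auto simp: closed_span_def)
  have "\<exists>K\<in>cfun.span (kern ` \<Lambda>). nrm (F + G - K) < \<epsilon>" if e: "\<epsilon> > 0" for \<epsilon>
  proof -
    obtain A B where A: "A \<in> cfun.span (kern ` \<Lambda>)" "nrm (F - A) < \<epsilon> / 2"
      and B: "B \<in> cfun.span (kern ` \<Lambda>)" "nrm (G - B) < \<epsilon> / 2"
      using FG e half_gt_zero[OF e] unfolding closed_span_def by blast
    have "nrm (F + G - (A + B)) = nrm ((F - A) + (G - B))" by (simp add: algebra_simps)
    also have "\<dots> \<le> nrm (F - A) + nrm (G - B)"
      using A B SH H by (intro nrm_triangle diff_mem) auto
    also have "\<dots> < \<epsilon>" using A B by simp
    finally show ?thesis using cfun.span_add[OF A(1) B(1)] by blast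
  qed
  then show "F + G \<in> closed_span E kern \<Lambda>" using H add_mem by (simp add: closed_span_def)
next
  fix c F assume F: "F \<in> closed_span E kern \<Lambda>"
  note SH = span_kernels[THEN conjunct1]
  have H: "F \<in> H" using F by (auto simp: closed_span_def)
  have "\<exists>K\<in>cfun.span (kern ` \<Lambda>). nrm ((\<lambda>z. c * F z) - K) < \<epsilon>" if e: "\<epsilon> > 0" for \<epsilon>
  proof -
    have "0 < \<epsilon> / (norm c + 1)" using e by (simp add: add_nonneg_pos)
    then obtain A where A: "A \<in> cfun.span (kern ` \<Lambda>)" "nrm (F - A) < \<epsilon> / (norm c + 1)"
      using F unfolding closed_span_def by blast
    have "(\<lambda>z. c * F z) - (\<lambda>z. c * A z) = (\<lambda>z. c * (F - A) z)" by (auto simp: algebra_simps)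
    then have "nrm ((\<lambda>z. c * F z) - (\<lambda>z. c * A z)) = norm c * nrm (F - A)"
      using nrm_cmult[OF diff_mem[OF H SH[OF A(1)]]] by simp
    also have "\<dots> \<le> norm c * (\<epsilon> / (norm c + 1))" using A by (intro mult_left_mono) auto
    also have "\<dots> = \<epsilon> * (norm c / (norm c + 1))" by simp
    also have "\<dots> < \<epsilon> * 1" using e by (intro mult_strict_left_mono) (auto simp: divide_less_eq add_nonneg_pos)
    finally show ?thesis unfolding mult_1_right using cfun.span_scale[OF A(1), of c] by blast
  qed
  then show "(\<lambda>z. c * F z) \<in> closed_span E kern \<Lambda>" using H cmult_mem by (simp add: closed_span_def)
next
  fix K G assume K: "\<forall>n::nat. K n \<in> closed_span E kern \<Lambda>" and G: "G \<in> H" and lim: "(\<lambda>n. nrm (K n - G)) \<longlonglongrightarrow> 0"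
  note SH = span_kernels[THEN conjunct1]
  have KH: "K n \<in> H" for n using K by (auto simp: closed_span_def)
  have "\<exists>A\<in>cfun.span (kern ` \<Lambda>). nrm (G - A) < \<epsilon>" if e: "\<epsilon> > 0" for \<epsilon>
  proof -
    obtain n where n: "nrm (K n - G) < \<epsilon> / 2"
      using order_tendstoD(2)[OF lim half_gt_zero[OF e]] eventually_happens'[OF sequentially_bot] by blast
    obtain A where A: "A \<in> cfun.span (kern ` \<Lambda>)" "nrm (K n - A) < \<epsilon> / 2"
      using K half_gt_zero[OF e] unfolding closed_span_def by blast
    have "nrm (G - A) = nrm ((G - K n) + (K n - A))" by (simp add: algebra_simps)
    also have "\<dots> \<le> nrm (G - K n) + nrm (K n - A)"
      using A SH KH G by (intro nrm_triangle diff_mem) auto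
    also have "\<dots> < \<epsilon>" using n A nrm_minus_commute[OF KH G, of n] by simp
    finally show ?thesis using A(1) by blast
  qed
  then show "G \<in> closed_span E kern \<Lambda>" using G by (simp add: closed_span_def)
qed

lemma kernel_in_closed_span: "\<mu> \<in> \<Lambda> \<Longrightarrow> kern \<mu> \<in> closed_span E kern \<Lambda>"
  unfolding closed_span_def
proof (intro CollectI conjI kernel_mem allI impI)
  assume \<mu>: "\<mu> \<in> \<Lambda>"
  show "\<exists>G\<in>cfun.span (kern ` \<Lambda>). nrm (kern \<mu> - G) < \<epsilon>" if "\<epsilon> > 0" for \<epsilon>
    by (rule bexI[OF _ cfun.span_base[OF imageI[OF \<mu>]]]) (use that in \<open>simp add: nrm_zero\<close>)
qed

text \<open>Project a function outside the closed span: the remainder is orthogonal to each kernel,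
  which by the reproducing property means that it vanishes on \<open>\<Lambda>\<close>.\<close>

lemma incomplete_imp_annihilator:
  assumes "\<not> complete_system E kern \<Lambda>"
  obtains F where "F \<in> H" "F \<noteq> 0" "\<And>\<mu>. \<mu> \<in> \<Lambda> \<Longrightarrow> F \<mu> = 0"
proof -
  note N = closed_subspace_closed_span[of \<Lambda>]
  obtain G where G: "G \<in> H" "G \<notin> closed_span E kern \<Lambda>"
    using assms closed_subspaceD(1)[OF N] by (auto simp: complete_system_def)
  obtain P where P: "P \<in> closed_span E kern \<Lambda>" and orth: "\<And>K. K \<in> closed_span E kern \<Lambda> \<Longrightarrow> ip (G - P) K = 0"
    using projection[OF N G(1)] by blast
  have D: "G - P \<in> H" using diff_mem G(1) P closed_subspaceD(1)[OF N] by blast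
  show ?thesis
  proof (rule that[OF D])
    show "G - P \<noteq> 0" using G P by auto
    show "(G - P) \<mu> = 0" if "\<mu> \<in> \<Lambda>" for \<mu>
      using orth[OF kernel_in_closed_span[OF that]] kernel_reproduces[OF D] by simp
  qed
qed

text \<open>\<open>G\<close> is orthogonal to the span but not to \<open>kern \<mu>\<close>;
  approximating \<open>kern \<mu>\<close> from the span would make \<open>G \<mu>\<close>
  arbitrarily small. Minimality is always proved through such a \<open>G\<close>.\<close>

lemma kernel_notin_closed_span:
  assumes G: "G \<in> H" "\<And>w. w \<in> \<Lambda> \<Longrightarrow> G w = 0" and nz: "G \<mu> \<noteq> 0"
  shows "kern \<mu> \<notin> closed_span E kern \<Lambda>"
proof
  assume k: "kern \<mu> \<in> closed_span E kern \<Lambda>"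
  have "norm (G \<mu>) \<le> nrm G * \<epsilon>" if e: "\<epsilon> > 0" for \<epsilon>
  proof -
    obtain A where A: "A \<in> cfun.span (kern ` \<Lambda>)" "nrm (kern \<mu> - A) < \<epsilon>"
      using k e by (auto simp: closed_span_def)
    have AH: "A \<in> H" "ip G A = 0" using span_kernels[OF A(1)] G by auto
    have "G \<mu> = ip G (kern \<mu> - A)"
      using G AH by (simp add: ip_diff_right kernel_mem kernel_reproduces)
    also have "norm \<dots> \<le> nrm G * nrm (kern \<mu> - A)"
      by (intro cauchy_schwarz G diff_mem kernel_mem AH)
    also have "\<dots> \<le> nrm G * \<epsilon>" using A G by (intro mult_left_mono) auto
    finally show ?thesis .
  qed
  \<comment> \<open>For this error the bound is at most half of
    \<open>norm (G \<mu>)\<close>.\<close>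
  from this[of "norm (G \<mu>) / (2 * (nrm G + 1))"] nz nrm_nonneg[OF G(1)]
  have "norm (G \<mu>) * (2 * (nrm G + 1)) \<le> nrm G * norm (G \<mu>)"
    by (simp add: field_simps)
  then have "2 * (nrm G + 1) \<le> nrm G" using nz by (simp add: mult.commute)
  then show False using nrm_nonneg[OF G(1)] by simp
qed

end

section \<open>Subspaces of functions with prescribed zeros\<close>

lemma entire_divide:
  assumes F: "F holomorphic_on UNIV" and "F w = 0"
  obtains G where "G holomorphic_on UNIV" "F = (\<lambda>z. (z - w) * G z)"
proof
  define G where "G = (\<lambda>z. if z = w then deriv F w else F z / (z - w))"
  show "G holomorphic_on UNIV"
    by (rule pole_theorem_open_0[OF F, of w]) (auto simp: G_def assms)
  show "F = (\<lambda>z. (z - w) * G z)" by (auto simp: G_def assms)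
qed

text \<open>The local factor near \<open>w\<close> and the quotient of \<open>F\<close> by
  \<open>(z - w) ^ n\<close> agree off \<open>w\<close>, so they glue to an entire function.\<close>

lemma entire_factor_zero:
  fixes F :: "complex \<Rightarrow> complex"
  assumes F: "F holomorphic_on UNIV" and nz: "F \<noteq> 0"
  obtains n G where "G holomorphic_on UNIV" "G w \<noteq> 0" "F = (\<lambda>z. (z - w) ^ n * G z)"
proof (cases "F w = 0")
  case False
  then show ?thesis using that[of F 0] F by simp
next
  case True
  have "\<not> F constant_on UNIV"
    using True nz by (force simp: constant_on_def fun_eq_iff)
  then obtain g r n where g: "0 < n" "0 < r" "g holomorphic_on ball w r"
      "\<And>z. z \<in> ball w r \<Longrightarrow> F z = (z - w) ^ n * g z" "\<And>z. z \<in> ball w r \<Longrightarrow> g z \<noteq> 0"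
    using holomorphic_factor_zero_nonconstant[OF F, of w] True by (metis UNIV_I connected_UNIV open_UNIV)
  define G where "G = (\<lambda>z. if z \<in> ball w r then g z else F z / (z - w) ^ n)"
  have G: "G z = F z / (z - w) ^ n" if "z \<noteq> w" for z
    using that g(4) by (auto simp: G_def)
  have "G holomorphic_on ball w r"
    by (rule holomorphic_transform[OF g(3)]) (auto simp: G_def)
  moreover have "G holomorphic_on - {w}"
  proof (rule holomorphic_transform)
    show "(\<lambda>z. F z / (z - w) ^ n) holomorphic_on - {w}"
      by (intro holomorphic_intros holomorphic_on_subset[OF F]) auto
  qed (auto simp: G)
  ultimately have "G holomorphic_on (ball w r \<union> - {w})"
    by (intro holomorphic_on_Un) auto
  also have "ball w r \<union> - {w} = UNIV" using g(2) by auto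
  finally have 1: "G holomorphic_on UNIV" .
  have 2: "G w \<noteq> 0" using g by (auto simp: G_def)
  have 3: "F = (\<lambda>z. (z - w) ^ n * G z)"
  proof
    fix z show "F z = (z - w) ^ n * G z"
      using True g(1) by (cases "z = w") (auto simp: G)
  qed
  from that[OF 1 2 3] show ?thesis .
qed

lemma entire_quotient_simple_zeros:
  assumes F: "F holomorphic_on UNIV" and S: "S holomorphic_on UNIV"
    and zero: "\<And>z. S z = 0 \<Longrightarrow> F z = 0"
    and simple: "\<And>w Q. Q holomorphic_on UNIV \<Longrightarrow> S = (\<lambda>z. (z - w) * Q z) \<Longrightarrow> Q w \<noteq> 0"
  obtains T where "T holomorphic_on UNIV" "F = (\<lambda>z. S z * T z)"
proof
  \<comment> \<open>At a zero of \<open>S\<close> the value is the limit of the quotient by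
    l'Hospital's rule; simplicity of the zeros keeps the denominator nonzero.\<close>
  define T where "T = (\<lambda>z. if S z = 0 then deriv F z / deriv S z else F z / S z)"
  show "F = (\<lambda>z. S z * T z)" using zero by (auto simp: T_def)
  have "T field_differentiable (at w)" for w
  proof (cases "S w = 0")
    case False
    define U where "U = {z. S z \<noteq> 0}"
    have U: "open U"
      unfolding U_def using continuous_open_vimage[of "- {0}" S] holomorphic_on_imp_continuous_on[OF S]
      by (auto simp: vimage_def continuous_on_eq_continuous_at)
    have "T holomorphic_on U"
    proof (rule holomorphic_transform)
      show "(\<lambda>z. F z / S z) holomorphic_on U"
        unfolding U_def by (intro holomorphic_intros holomorphic_on_subset[OF F] holomorphic_on_subset[OF S]) auto
    qed (auto simp: U_def T_def)
    then show ?thesis by (rule holomorphic_on_imp_differentiable_at[OF _ U]) (use False in \<open>simp add: U_def\<close>)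
  next
    case True
    obtain Q where Q: "Q holomorphic_on UNIV" "S = (\<lambda>z. (z - w) * Q z)" using entire_divide[OF S True] .
    obtain P where P: "P holomorphic_on UNIV" "F = (\<lambda>z. (z - w) * P z)" using entire_divide[OF F zero[OF True]] .
    have Qw: "Q w \<noteq> 0" by (rule simple[OF Q])
    \<comment> \<open>On this neighbourhood of \<open>w\<close> the common factor
      \<open>z - w\<close> cancels and \<open>T\<close> is \<open>P / Q\<close>.\<close>
    define U where "U = {z. Q z \<noteq> 0}"
    have U: "open U"
      unfolding U_def using continuous_open_vimage[of "- {0}" Q] holomorphic_on_imp_continuous_on[OF Q(1)]
      by (auto simp: vimage_def continuous_on_eq_continuous_at)
    have der: "deriv (\<lambda>z. (z - w) * R z) w = R w" if "R holomorphic_on UNIV" for R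
    proof (rule DERIV_imp_deriv)
      have "(R has_field_derivative deriv R w) (at w)"
        using that by (intro holomorphic_derivI) auto
      then show "((\<lambda>z. (z - w) * R z) has_field_derivative R w) (at w)"
        by (auto intro!: derivative_eq_intros)
    qed
    have dd: "deriv F w = P w" "deriv S w = Q w" using der P Q by auto
    have "T holomorphic_on U"
    proof (rule holomorphic_transform)
      show "(\<lambda>z. P z / Q z) holomorphic_on U"
        unfolding U_def by (intro holomorphic_intros holomorphic_on_subset[OF P(1)] holomorphic_on_subset[OF Q(1)]) auto
      fix z assume z: "z \<in> U"
      show "P z / Q z = T z"
      proof (cases "z = w")
        case True
        then show ?thesis using dd \<open>S w = 0\<close> by (simp add: T_def)
      next
        case False
        then have "S z \<noteq> 0" using z by (simp add: Q(2) U_def)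
        then have "T z = F z / S z" by (simp add: T_def)
        also have "\<dots> = P z / Q z" using False by (simp add: P(2) Q(2))
        finally show ?thesis by simp
      qed
    qed
    then show ?thesis by (rule holomorphic_on_imp_differentiable_at[OF _ U]) (use Qw in \<open>simp add: U_def\<close>)
  qed
  then show "T holomorphic_on UNIV" by (simp add: holomorphic_on_def)
qed

text \<open>No disc is countable, so the exceptional set has no interior. This extends estimates
  across the points where a division was not allowed.\<close>

lemma closed_cocountable:
  fixes P :: "complex \<Rightarrow> bool"
  assumes "closed {u. P u}" and N: "countable N" and P: "\<And>u. u \<notin> N \<Longrightarrow> P u"
  shows "P u"
proof (rule ccontr)
  assume "\<not> P u"
  moreover have "open (- {u. P u})" using assms(1) by (rule open_Compl)
  ultimately obtain e where e: "0 < e" "ball u e \<subseteq> - {u. P u}" by (auto elim: openE)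
  then have "ball u e \<subseteq> N" using P by auto
  then have "countable (ball u e)" using N countable_subset by blast
  then show False using uncountable_ball[OF e(1)] by blast
qed

text \<open>\<open>circle_bound\<close> removes the factor \<open>|Im u|\<close> and gains one power
  of the radius, exactly matching the linear growth on the right; a uniform bound remains for
  Liouville's theorem.\<close>

lemma entire_constant_if_bounded_off_real_axis:
  assumes T: "T holomorphic_on UNIV" and A: "0 \<le> A" and N: "countable N"
    and bound: "\<And>u. u \<notin> N \<Longrightarrow> \<bar>Im u\<bar> * norm (T u) \<le> A * (1 + norm u)"
  obtains c where "T = (\<lambda>z. c)"
proof -
  have cont: "continuous_on UNIV T" by (rule holomorphic_on_imp_continuous_on[OF T])
  have all: "\<bar>Im u\<bar> * norm (T u) \<le> A * (1 + norm u)" for u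
  proof (rule closed_cocountable[OF _ N bound])
    show "closed {u. \<bar>Im u\<bar> * norm (T u) \<le> A * (1 + norm u)}"
      by (intro closed_Collect_le continuous_intros cont)
  qed
  have "norm (T z) \<le> 4 * A" for z
  proof -
    \<comment> \<open>\<open>r \<ge> 1\<close> allows \<open>1 + 2 * r \<le> 3 * r\<close>; on the
      circle of radius \<open>2 * r\<close> this leads to
      \<open>4 r * 3 r A / (3 r^2) = 4 A\<close>.\<close>
    define r where "r = max 1 (norm z)"
    have r: "1 \<le> r" "norm z \<le> r" by (auto simp: r_def)
    have "norm (T z) \<le> 2 * (2 * r) * (A * (3 * r)) / ((2 * r)\<^sup>2 - r\<^sup>2)"
    proof (rule circle_bound[OF T])
      fix w :: complex assume w: "norm w = 2 * r"
      have "\<bar>Im w\<bar> * norm (T w) \<le> A * (1 + 2 * r)" using all[of w] w by simp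
      also have "\<dots> \<le> A * (3 * r)" using r A by (intro mult_left_mono) auto
      finally show "\<bar>Im w\<bar> * norm (T w) \<le> A * (3 * r)" .
    qed (use r in auto)
    also have "\<dots> = 4 * A" using r by (simp add: field_simps power2_eq_square)
    finally show ?thesis .
  qed
  then have "bounded (range T)" unfolding bounded_iff by blast
  then have "T constant_on UNIV" by (rule Liouville_theorem[OF T])
  then show ?thesis using that by (auto simp: constant_on_def fun_eq_iff)
qed

context de_branges
begin

text \<open>The space \<open>M\<close> of the overview; by the reproducing property it is the
  orthogonal complement of the kernels at \<open>\<Lambda>\<close>.\<close>

definition annihilator :: "complex set \<Rightarrow> (complex \<Rightarrow> complex) set" where
  "annihilator \<Lambda> = {F \<in> H. \<forall>z\<in>\<Lambda>. F z = 0}"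

lemma closed_subspace_annihilator: "closed_subspace (annihilator \<Lambda>)"
  unfolding annihilator_def by (rule closed_subspace_zeros)

lemmas annihilator_add = closed_subspaceD(3)[OF closed_subspace_annihilator]
  and annihilator_cmult = closed_subspaceD(4)[OF closed_subspace_annihilator]
  and annihilator_diff = closed_subspace_diff[OF closed_subspace_annihilator]

lemma annihilator_mem: "F \<in> annihilator \<Lambda> \<Longrightarrow> F \<in> H"
  by (simp add: annihilator_def)

text \<open>For \<open>w \<in> \<Lambda>\<close>, dividing by \<open>z - w\<close> could destroy the
  prescribed zero there; the last premise prevents it.\<close>

lemma annihilator_divide:
  assumes "(\<lambda>z. (z - w) * G z) \<in> annihilator \<Lambda>" "G holomorphic_on UNIV" "w \<in> \<Lambda> \<Longrightarrow> G w = 0"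
  shows "G \<in> annihilator \<Lambda>"
proof -
  have "G \<in> H" using assms divide_mem unfolding annihilator_def by blast
  moreover have "G z = 0" if "z \<in> \<Lambda>" for z
    using assms(1,3) that by (cases "z = w") (auto simp: annihilator_def)
  ultimately show ?thesis by (simp add: annihilator_def)
qed

text \<open>No zero is prescribed at \<open>w\<close>, so all factors \<open>z - w\<close> can be
  removed one at a time.\<close>

lemma annihilator_nonvanishing:
  assumes "annihilator \<Lambda> \<noteq> {0}" "w \<notin> \<Lambda>"
  obtains F where "F \<in> annihilator \<Lambda>" "F w \<noteq> 0"
proof -
  obtain F where F: "F \<in> annihilator \<Lambda>" "F \<noteq> 0"
    using assms(1) closed_subspaceD(2)[OF closed_subspace_annihilator] by blast
  obtain n G where G: "G holomorphic_on UNIV" "G w \<noteq> 0" "F = (\<lambda>z. (z - w) ^ n * G z)"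
    using entire_factor_zero[OF entire[OF annihilator_mem[OF F(1)]] F(2)] by metis
  have "G \<in> annihilator \<Lambda>" if "(\<lambda>z. (z - w) ^ n * G z) \<in> annihilator \<Lambda>" for n
    using that
  proof (induction n)
    case (Suc n)
    have "(\<lambda>z. (z - w) ^ n * G z) \<in> annihilator \<Lambda>"
      by (rule annihilator_divide[where w = w]) (use Suc.prems assms(2) in \<open>auto simp: mult.assoc intro!: holomorphic_intros G\<close>)
    then show ?case by (rule Suc.IH)
  qed simp
  then show ?thesis using that[of G] F(1) G by simp
qed

text \<open>The counterpart at a prescribed zero: the removal stops with one factor left.\<close>

lemma annihilator_simple_zero:
  assumes "annihilator \<Lambda> \<noteq> {0}" "w \<in> \<Lambda>"
  obtains G where "G holomorphic_on UNIV" "G w \<noteq> 0" "(\<lambda>z. (z - w) * G z) \<in> annihilator \<Lambda>"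
proof -
  obtain F where F: "F \<in> annihilator \<Lambda>" "F \<noteq> 0"
    using assms(1) closed_subspaceD(2)[OF closed_subspace_annihilator] by blast
  obtain n G where G: "G holomorphic_on UNIV" "G w \<noteq> 0" "F = (\<lambda>z. (z - w) ^ n * G z)"
    using entire_factor_zero[OF entire[OF annihilator_mem[OF F(1)]] F(2)] by metis
  have "n \<noteq> 0" using F(1) G assms(2) by (auto simp: annihilator_def)
  then obtain m where m: "n = Suc m" using not0_implies_Suc by blast
  have "(\<lambda>z. (z - w) * G z) \<in> annihilator \<Lambda>" if "(\<lambda>z. (z - w) ^ Suc m * G z) \<in> annihilator \<Lambda>" for m
    using that
  proof (induction m)
    case (Suc m)
    have "(\<lambda>z. (z - w) ^ Suc m * G z) \<in> annihilator \<Lambda>"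
      by (rule annihilator_divide[where w = w]) (use Suc.prems in \<open>auto simp: mult.assoc intro!: holomorphic_intros G\<close>)
    then show ?case by (rule Suc.IH)
  qed simp
  then show ?thesis using that[of G] F(1) G unfolding m by blast
qed

text \<open>On the real axis \<open>t - x\<close> is its own conjugate and may be moved to the other
  argument.\<close>

lemma ip_multiplication_real: "Im (ip (\<lambda>z. (z - of_real x) * P z) P) = 0"
proof -
  have "ip (\<lambda>z. (z - of_real x) * P z) P = ip P (\<lambda>z. (z - of_real x) * P z)"
    unfolding db_inner_def by (intro Bochner_Integration.integral_cong) simp_all
  also have "\<dots> = cnj (ip (\<lambda>z. (z - of_real x) * P z) P)" by (rule ip_cnj)
  finally show ?thesis by (simp add: complex_eq_iff)
qed

lemma eval_riesz:
  obtains K where "K \<in> annihilator \<Lambda>" "\<And>F. F \<in> annihilator \<Lambda> \<Longrightarrow> ip F K = F w"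
proof -
  obtain C where C: "\<And>F. F \<in> H \<Longrightarrow> norm (F w) \<le> C * nrm F"
    using eval_bound[of "norm w"] by (metis order_refl)
  show ?thesis
    by (rule riesz[OF closed_subspace_annihilator, of \<Lambda> "\<lambda>F. F w" C])
       (use C annihilator_mem that in auto)
qed

text \<open>Cauchy's inequality on the unit circle about \<open>w\<close> bounds the derivative. The
  representer is what ties \<open>deriv K w\<close> to the choice of \<open>x\<close>.\<close>

lemma deriv_riesz:
  obtains D where "D \<in> annihilator \<Lambda>" "\<And>F. F \<in> annihilator \<Lambda> \<Longrightarrow> ip F D = deriv F w"
proof -
  obtain C where C: "\<And>F (z::complex). F \<in> H \<Longrightarrow> norm z \<le> norm w + 1 \<Longrightarrow> norm (F z) \<le> C * nrm F"
    using eval_bound[of "norm w + 1"] by blast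
  have fd: "F field_differentiable (at w)" if "F \<in> annihilator \<Lambda>" for F
    using entire[OF annihilator_mem[OF that]] by (simp add: holomorphic_on_def)
  show ?thesis
  proof (rule riesz[OF closed_subspace_annihilator, of \<Lambda> "\<lambda>F. deriv F w" C])
    show "deriv (F + G) w = deriv F w + deriv G w" if "F \<in> annihilator \<Lambda>" "G \<in> annihilator \<Lambda>" for F G
      using deriv_add[OF fd fd] that by (simp add: plus_fun_def)
    show "deriv (\<lambda>z. c * F z) w = c * deriv F w" if "F \<in> annihilator \<Lambda>" for F c
      using deriv_cmult[OF fd] that by simp
    show "norm (deriv F w) \<le> C * nrm F" if F: "F \<in> annihilator \<Lambda>" for F
    proof -
      have "norm ((deriv ^^ 1) F w) \<le> fact 1 * (C * nrm F) / 1 ^ 1"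
      proof (rule Cauchy_inequality)
        show "F holomorphic_on ball w 1" "continuous_on (cball w 1) F"
          using entire[OF annihilator_mem[OF F]] holomorphic_on_subset holomorphic_on_imp_continuous_on by blast+
        fix z assume "norm (w - z) = 1"
        then have "norm z \<le> norm w + 1" using norm_triangle_sub[of z w] by (simp add: norm_minus_commute)
        then show "norm (F z) \<le> C * nrm F" by (rule C[OF annihilator_mem[OF F]])
      qed simp
      then show ?thesis by simp
    qed
  qed (use that in blast)
qed

end

section \<open>The resolvent estimate\<close>

text \<open>\<open>K_simple\<close> is demanded only where the resolvent estimate cannot supply
  simplicity; \<open>exists_annihilator_kernel\<close> finds an \<open>x\<close> for which it
  holds.\<close>

locale annihilator_kernel = de_branges +
  fixes \<Lambda> :: "complex set" and x :: real and K :: "complex \<Rightarrow> complex"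
  assumes K_mem: "K \<in> annihilator \<Lambda>" and K_reproduces: "F \<in> annihilator \<Lambda> \<Longrightarrow> ip F K = F (of_real x)"
    and K_nonzero: "K (of_real x) \<noteq> 0"
    and K_simple: "\<lbrakk>w \<in> \<Lambda>; Im w = 0\<rbrakk> \<Longrightarrow> deriv K w \<noteq> 0"
begin

definition S :: "complex \<Rightarrow> complex" where
  "S z = (z - of_real x) * K z"

abbreviation "M \<equiv> annihilator \<Lambda>"

lemmas MH = annihilator_mem[of _ \<Lambda>]

lemma K_entire: "K holomorphic_on UNIV"
  by (rule entire[OF MH[OF K_mem]])

lemma S_entire: "S holomorphic_on UNIV"
  unfolding S_def by (intro holomorphic_intros K_entire)

lemma K_zero: "w \<in> \<Lambda> \<Longrightarrow> K w = 0"
  using K_mem by (simp add: annihilator_def)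

lemma S_zero: "w \<in> \<Lambda> \<Longrightarrow> S w = 0"
  by (simp add: S_def K_zero)

lemma M_nontrivial: "M \<noteq> {0}"
proof
  assume "M = {0}"
  then have "K = 0" using K_mem by blast
  then show False using K_nonzero by simp
qed

lemma K_countable_zeros: "countable {z. K z = 0}"
  using K_nonzero by (intro entire_countable_zeros K_entire) auto

lemma S_nonzero: obtains w where "S w \<noteq> 0"
proof -
  have "countable ({z. K z = 0} \<union> {of_real x})" using K_countable_zeros by simp
  then have "\<not> UNIV \<subseteq> {z. K z = 0} \<union> {of_real x}" using countable_subset uncountable_UNIV_complex by blast
  then obtain w where "w \<notin> {z. K z = 0} \<union> {of_real x}" by blast
  then show ?thesis using that[of w] by (simp add: S_def)
qed

text \<open>\<open>Q = (z - x) P\<close> lies in \<open>M\<close> and vanishes at \<open>x\<close>,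
  hence is orthogonal to \<open>K\<close>. Since \<open>G\<close> and \<open>P\<close> differ by a
  multiple of \<open>K\<close>, \<open>ip Q G = ip Q P\<close>, which is real. With
  \<open>Q = (u - x) G + F\<close>, taking imaginary parts and applying Cauchy-Schwarz gives the
  estimate.\<close>

lemma resolvent_bound:
  assumes F: "F \<in> M" and u: "Im u \<noteq> 0" "K u \<noteq> 0"
  obtains G where "G \<in> M" "\<And>z. (z - u) * G z = F z - F u / S u * S z" "\<bar>Im u\<bar> * nrm G \<le> nrm F"
proof -
  have ux: "u \<noteq> of_real x" using u(1) by auto
  define T where "T = F u / S u"
  have FuK: "F u / K u = T * (u - of_real x)" using ux u(2) by (simp add: T_def S_def)
  \<comment> \<open>Subtracting a multiple of \<open>K\<close>, rather than of \<open>S\<close>,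
    creates the zero at \<open>u\<close> without leaving \<open>M\<close>; \<open>S\<close> may lie
    outside \<open>H\<close>.\<close>
  define L where "L = F - (\<lambda>z. (F u / K u) * K z)"
  have L: "L \<in> M" unfolding L_def by (intro annihilator_diff F annihilator_cmult K_mem)
  have "L u = 0" using u(2) by (simp add: L_def)
  then obtain P where P: "P holomorphic_on UNIV" "L = (\<lambda>z. (z - u) * P z)"
    using entire_divide[OF entire[OF MH[OF L]]] by metis
  \<comment> \<open>\<open>K u \<noteq> 0\<close> rules out \<open>u \<in> \<Lambda>\<close>, so no
    prescribed zero is lost.\<close>
  have PM: "P \<in> M"
    by (rule annihilator_divide[OF _ P(1), of u]) (use L P(2) K_zero u(2) in auto)
  \<comment> \<open>This correction turns the subtracted multiple of \<open>K\<close> into one of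
    \<open>S\<close>.\<close>
  define G where "G = P - (\<lambda>z. T * K z)"
  have G: "G \<in> M" unfolding G_def by (intro annihilator_diff PM annihilator_cmult K_mem)
  have eq: "(z - u) * G z = F z - T * S z" for z
  proof -
    have "(z - u) * P z = F z - T * (u - of_real x) * K z"
      using fun_cong[OF P(2), of z] by (simp add: L_def FuK[symmetric])
    then have "(z - u) * G z = F z - T * (u - of_real x) * K z - (z - u) * (T * K z)"
      by (simp add: G_def right_diff_distrib)
    also have "\<dots> = F z - T * S z" by (simp add: S_def algebra_simps)
    finally show ?thesis .
  qed
  define Q where "Q = (\<lambda>z. (z - of_real x) * P z)"
  define uG where "uG = (\<lambda>z. (u - of_real x) * G z)"
  have uG: "uG \<in> M" unfolding uG_def by (intro annihilator_cmult G)
  have Q_eq: "Q = uG + F"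
  proof
    fix z
    have "Q z = (z - of_real x) * (G z + T * K z)" by (simp add: Q_def G_def)
    also have "\<dots> = (u - of_real x) * G z + ((z - u) * G z + T * S z)" by (simp add: S_def algebra_simps)
    also have "\<dots> = (uG + F) z" unfolding eq by (simp add: uG_def)
    finally show "Q z = (uG + F) z" .
  qed
  have QM: "Q \<in> M" unfolding Q_eq by (intro annihilator_add uG F)
  have "ip Q K = Q (of_real x)" by (rule K_reproduces[OF QM])
  then have QK: "ip Q K = 0" by (simp add: Q_def)
  have TK: "(\<lambda>z. T * K z) \<in> M" by (intro annihilator_cmult K_mem)
  have "ip Q G = ip Q P - ip Q (\<lambda>z. T * K z)"
    unfolding G_def by (rule ip_diff_right[OF MH[OF PM] MH[OF TK] MH[OF QM]])
  also have "\<dots> = ip Q P" unfolding ip_cmult_right QK by simp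
  finally have "Im (ip Q G) = 0" unfolding Q_def by (simp only: ip_multiplication_real)
  moreover have "ip Q G = (u - of_real x) * of_real ((nrm G)\<^sup>2) + ip F G"
  proof -
    have "ip Q G = ip uG G + ip F G" unfolding Q_eq by (rule ip_add_left[OF MH[OF uG] MH[OF F] MH[OF G]])
    then show ?thesis unfolding uG_def ip_cmult_left ip_self[OF MH[OF G]] .
  qed
  ultimately have Im_eq: "Im u * (nrm G)\<^sup>2 = - Im (ip F G)"
    by simp
  have "\<bar>Im u\<bar> * (nrm G)\<^sup>2 = \<bar>Im u * (nrm G)\<^sup>2\<bar>"
    by (simp add: abs_mult)
  also have "\<dots> \<le> norm (ip F G)"
    unfolding Im_eq using abs_Im_le_cmod[of "ip F G"] by simp
  also have "\<dots> \<le> nrm F * nrm G" by (rule cauchy_schwarz[OF MH[OF F] MH[OF G]])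
  finally have "(\<bar>Im u\<bar> * nrm G) * nrm G \<le> nrm F * nrm G"
    by (simp add: power2_eq_square mult.assoc)
  then have "\<bar>Im u\<bar> * nrm G \<le> nrm F"
    using nrm_nonneg[OF MH[OF G]] nrm_nonneg[OF MH[OF F]] by (cases "nrm G = 0") (auto simp: mult_le_cancel_right)
  then show ?thesis using that[OF G] eq by (simp add: T_def)
qed

text \<open>At a fixed \<open>w\<close> with \<open>S w \<noteq> 0\<close> the resolvent identity
  expresses \<open>F u / S u\<close> through \<open>F w\<close> and \<open>G w\<close>, and
  \<open>norm (G w)\<close> is at most a constant over \<open>|Im u|\<close>. In multiplied-out form
  the estimate passes to limits and so extends to the zeros of \<open>K\<close>.\<close>

lemma ratio_bound:
  assumes F: "F \<in> M"
  obtains A where "0 \<le> A" "\<And>u. \<bar>Im u\<bar> * norm (F u) \<le> A * (1 + norm u) * norm (S u)"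
proof -
  obtain w where w: "S w \<noteq> 0" by (rule S_nonzero)
  obtain C where C0: "0 \<le> C" and C: "\<And>F. F \<in> H \<Longrightarrow> norm (F w) \<le> C * nrm F"
    using eval_bound[of "norm w"] by (metis order_refl)
  note nF = nrm_nonneg[OF MH[OF F]]
  define A where "A = (norm (F w) + (1 + norm w) * (C * nrm F)) / norm (S w)"
  have A: "0 \<le> A" using C0 nF by (simp add: A_def add_nonneg_nonneg)
  have main: "\<bar>Im u\<bar> * norm (F u) \<le> A * (1 + norm u) * norm (S u)" if u: "K u \<noteq> 0" for u
  proof (cases "Im u = 0")
    case True
    then show ?thesis using A by simp
  next
    case False
    have Su: "S u \<noteq> 0" using u False by (auto simp: S_def)
    obtain G where G: "G \<in> M" "\<And>z. (z - u) * G z = F z - F u / S u * S z" "\<bar>Im u\<bar> * nrm G \<le> nrm F"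
      using resolvent_bound[OF F False u] by blast
    have "\<bar>Im u\<bar> * norm (G w) \<le> C * (\<bar>Im u\<bar> * nrm G)"
      using mult_left_mono[OF C[OF MH[OF G(1)]], of "\<bar>Im u\<bar>"] by (simp add: mult_ac)
    also have "\<dots> \<le> C * nrm F" by (rule mult_left_mono[OF G(3) C0])
    finally have Gw: "\<bar>Im u\<bar> * norm (G w) \<le> C * nrm F" .
    have "F u / S u * S w = F w - (w - u) * G w" using G(2)[of w] by simp
    then have "norm (F u / S u) * norm (S w) \<le> norm (F w) + norm (w - u) * norm (G w)"
      by (metis norm_mult norm_triangle_ineq4)
    then have "\<bar>Im u\<bar> * (norm (F u / S u) * norm (S w)) \<le> \<bar>Im u\<bar> * (norm (F w) + norm (w - u) * norm (G w))"
      by (rule mult_left_mono) simp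
    also have "\<dots> = \<bar>Im u\<bar> * norm (F w) + norm (w - u) * (\<bar>Im u\<bar> * norm (G w))"
      by (simp add: algebra_simps)
    also have "\<dots> \<le> (1 + norm u) * norm (F w) + ((1 + norm w) * (1 + norm u)) * (C * nrm F)"
    proof (rule add_mono)
      show "\<bar>Im u\<bar> * norm (F w) \<le> (1 + norm u) * norm (F w)"
        using abs_Im_le_cmod[of u] by (intro mult_right_mono) auto
      have "norm (w - u) \<le> norm w + norm u" by (rule norm_triangle_ineq4)
      also have "\<dots> \<le> (1 + norm w) * (1 + norm u)" by (simp add: algebra_simps)
      finally show "norm (w - u) * (\<bar>Im u\<bar> * norm (G w)) \<le> ((1 + norm w) * (1 + norm u)) * (C * nrm F)"
        using Gw by (rule mult_mono) auto
    qed
    also have "\<dots> = A * norm (S w) * (1 + norm u)"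
    proof -
      have "A * norm (S w) = norm (F w) + (1 + norm w) * (C * nrm F)" using w by (simp add: A_def)
      then show ?thesis by (simp add: algebra_simps)
    qed
    finally have "norm (S w) * (\<bar>Im u\<bar> * norm (F u / S u)) \<le> norm (S w) * (A * (1 + norm u))"
      by (simp add: mult_ac)
    then have "\<bar>Im u\<bar> * norm (F u / S u) \<le> A * (1 + norm u)"
      using w by (simp add: mult_le_cancel_left)
    then have "\<bar>Im u\<bar> * norm (F u / S u) * norm (S u) \<le> A * (1 + norm u) * norm (S u)"
      by (rule mult_right_mono) simp
    then show ?thesis using Su by (simp add: norm_divide)
  qed
  have "\<bar>Im u\<bar> * norm (F u) \<le> A * (1 + norm u) * norm (S u)" for u
  proof (rule closed_cocountable[where P = "\<lambda>u. \<bar>Im u\<bar> * norm (F u) \<le> A * (1 + norm u) * norm (S u)", OF _ K_countable_zeros])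
    show "closed {u. \<bar>Im u\<bar> * norm (F u) \<le> A * (1 + norm u) * norm (S u)}"
      by (intro closed_Collect_le continuous_intros holomorphic_on_imp_continuous_on[OF entire[OF MH[OF F]]]
          holomorphic_on_imp_continuous_on[OF S_entire])
  qed (use main in auto)
  with A show ?thesis by (rule that)
qed

text \<open>If \<open>Q w\<close> vanished, \<open>F / S\<close> would grow faster near
  \<open>w\<close> than \<open>ratio_bound\<close> permits, for a suitable \<open>F\<close> in
  \<open>M\<close>. Only real points of \<open>\<Lambda>\<close> escape this argument and fall under
  \<open>K_simple\<close>.\<close>

lemma S_simple_zeros:
  assumes Q: "Q holomorphic_on UNIV" and SQ: "S = (\<lambda>z. (z - w) * Q z)"
  shows "Q w \<noteq> 0"
proof
  assume Qw: "Q w = 0"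
  have S': "norm (S u) = norm (u - w) * norm (Q u)" for u
    using fun_cong[OF SQ, of u] by (simp add: norm_mult)
  have Qc: "isCont Q u" for u
    using holomorphic_on_imp_continuous_on[OF Q] by (simp add: continuous_on_eq_continuous_at)
  consider "w \<notin> \<Lambda>" "Im w \<noteq> 0" | "w \<notin> \<Lambda>" "Im w = 0" | "w \<in> \<Lambda>" "Im w \<noteq> 0" | "w \<in> \<Lambda>" "Im w = 0" by blast
  then show False
  proof cases
    case 1
    \<comment> \<open>Here \<open>S w = 0\<close> is already impossible: the nonreal zeros of
      \<open>S\<close> all lie in \<open>\<Lambda>\<close>.\<close>
    obtain F where F: "F \<in> M" "F w \<noteq> 0" using annihilator_nonvanishing[OF M_nontrivial 1(1)] .
    obtain A where "\<And>u. \<bar>Im u\<bar> * norm (F u) \<le> A * (1 + norm u) * norm (S u)" using ratio_bound[OF F(1)] by blast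
    from this[of w] show False using 1 F by (simp add: S' mult_le_0_iff)
  next
    case 2
    obtain F where F: "F \<in> M" "F w \<noteq> 0" using annihilator_nonvanishing[OF M_nontrivial 2(1)] .
    obtain A where A: "\<And>u. \<bar>Im u\<bar> * norm (F u) \<le> A * (1 + norm u) * norm (S u)" using ratio_bound[OF F(1)] by blast
    \<comment> \<open>On the vertical through \<open>w\<close>, \<open>|Im u| = |u - w|\<close>, so
      the bound cancels exactly one factor of \<open>S\<close>, and the remaining \<open>Q\<close>
      still tends to 0.\<close>
    define v where "v = (\<lambda>n. w + \<i> * of_real (1 / real (Suc n)))"
    have le: "norm (F (v n)) \<le> A * (1 + norm (v n)) * norm (Q (v n))" for n
    proof -
      have v: "v n - w = \<i> * of_real (1 / real (Suc n))" "Im (v n) = 1 / real (Suc n)"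
        using 2 by (auto simp: v_def)
      have nv: "norm (v n - w) = 1 / real (Suc n)"
        unfolding v(1) by (simp add: norm_mult norm_divide del: of_nat_Suc)
      have "1 / real (Suc n) * norm (F (v n)) \<le> A * (1 + norm (v n)) * (1 / real (Suc n) * norm (Q (v n)))"
        using A[of "v n"] unfolding S' v(2) nv by simp
      then have "1 / real (Suc n) * norm (F (v n)) \<le> 1 / real (Suc n) * (A * (1 + norm (v n)) * norm (Q (v n)))"
        by (simp only: mult_ac)
      then show ?thesis by (rule mult_left_le_imp_le) simp
    qed
    have "(\<lambda>n. 1 / real (Suc n)) \<longlonglongrightarrow> 0" using LIMSEQ_Suc[OF lim_1_over_n] .
    then have "v \<longlonglongrightarrow> w + \<i> * of_real 0"
      unfolding v_def by (intro tendsto_intros)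
    then have v: "v \<longlonglongrightarrow> w" by simp
    have Fc: "isCont F w"
      using holomorphic_on_imp_continuous_on[OF entire[OF MH[OF F(1)]]] by (simp add: continuous_on_eq_continuous_at)
    have "norm (F w) \<le> A * (1 + norm w) * norm (Q w)"
    proof (rule LIMSEQ_le)
      show "(\<lambda>n. norm (F (v n))) \<longlonglongrightarrow> norm (F w)"
        by (intro tendsto_intros isCont_tendsto_compose[OF Fc v])
      show "(\<lambda>n. A * (1 + norm (v n)) * norm (Q (v n))) \<longlonglongrightarrow> A * (1 + norm w) * norm (Q w)"
        by (intro tendsto_intros isCont_tendsto_compose[OF Qc v] v)
    qed (use le in blast)
    then show False using F Qw by simp
  next
    case 3
    obtain G where G: "G holomorphic_on UNIV" "G w \<noteq> 0" "(\<lambda>z. (z - w) * G z) \<in> M"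
      using annihilator_simple_zero[OF M_nontrivial 3(1)] .
    obtain A where A: "\<And>u. \<bar>Im u\<bar> * norm ((u - w) * G u) \<le> A * (1 + norm u) * norm (S u)" using ratio_bound[OF G(3)] by blast
    \<comment> \<open>The simple zero of the test function cancels the factor \<open>u - w\<close>
      of \<open>S\<close> for \<open>u \<noteq> w\<close>; closedness yields the inequality at
      \<open>w\<close>, where \<open>Im w\<close> is not 0.\<close>
    have "\<bar>Im w\<bar> * norm (G w) \<le> A * (1 + norm w) * norm (Q w)"
    proof (rule closed_cocountable[where P = "\<lambda>u. \<bar>Im u\<bar> * norm (G u) \<le> A * (1 + norm u) * norm (Q u)" and N = "{w}"])
      show "closed {u. \<bar>Im u\<bar> * norm (G u) \<le> A * (1 + norm u) * norm (Q u)}"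
        by (intro closed_Collect_le continuous_intros holomorphic_on_imp_continuous_on[OF G(1)]
            holomorphic_on_imp_continuous_on[OF Q])
      fix u assume "u \<notin> {w}"
      then have "0 < norm (u - w)" by simp
      moreover have "norm (u - w) * (\<bar>Im u\<bar> * norm (G u)) \<le> norm (u - w) * (A * (1 + norm u) * norm (Q u))"
        using A[of u] unfolding S' norm_mult by (simp only: mult_ac)
      ultimately show "\<bar>Im u\<bar> * norm (G u) \<le> A * (1 + norm u) * norm (Q u)"
        by (simp only: mult_le_cancel_left_pos)
    qed simp
    then show False using G 3 Qw by (simp add: mult_le_0_iff)
  next
    case 4
    have wx: "w \<noteq> of_real x" using K_zero[OF 4(1)] K_nonzero by auto
    \<comment> \<open>The two factorisations of \<open>S\<close> are differentiated at
      \<open>w\<close>: one gives \<open>(w - x) * deriv K w\<close>, the other 0.\<close>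
    have K': "(K has_field_derivative deriv K w) (at w)"
      using K_entire by (intro holomorphic_derivI) auto
    have "((\<lambda>z. (z - of_real x) * K z) has_field_derivative (w - of_real x) * deriv K w) (at w)"
      using K' K_zero[OF 4(1)] by (auto intro!: derivative_eq_intros)
    moreover have "(\<lambda>z. (z - of_real x) * K z) = (\<lambda>z. (z - w) * Q z)"
      using SQ by (simp add: S_def fun_eq_iff)
    moreover have "((\<lambda>z. (z - w) * Q z) has_field_derivative 0) (at w)"
    proof -
      have "(Q has_field_derivative deriv Q w) (at w)" using Q by (intro holomorphic_derivI) auto
      then show ?thesis using Qw by (auto intro!: derivative_eq_intros)
    qed
    ultimately have "(w - of_real x) * deriv K w = 0" by (metis DERIV_unique)
    then show False using wx K_simple[OF 4] by simp
  qed
qed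

lemma vanishing_imp_multiple:
  assumes F: "F \<in> H" and zero: "\<And>z. S z = 0 \<Longrightarrow> F z = 0"
  obtains c where "F = (\<lambda>z. c * S z)"
proof -
  have FM: "F \<in> M" using F zero[OF S_zero] unfolding annihilator_def by blast
  obtain T where T: "T holomorphic_on UNIV" "F = (\<lambda>z. S z * T z)"
  proof (rule entire_quotient_simple_zeros[OF entire[OF F] S_entire])
    show "F z = 0" if "S z = 0" for z using that by (rule zero)
    show "Q w \<noteq> 0" if "Q holomorphic_on UNIV" "S = (\<lambda>z. (z - w) * Q z)" for w Q
      using that by (rule S_simple_zeros)
  qed
  obtain A where A: "0 \<le> A" "\<And>u. \<bar>Im u\<bar> * norm (F u) \<le> A * (1 + norm u) * norm (S u)" using ratio_bound[OF FM] by blast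
  obtain w where w: "S w \<noteq> 0" by (rule S_nonzero)
  have "countable {z. S z = 0}" by (rule entire_countable_zeros[OF S_entire]) (use w in auto)
  then obtain c where "T = (\<lambda>z. c)"
  proof (rule entire_constant_if_bounded_off_real_axis[OF T(1) A(1)])
    fix u assume "u \<notin> {z. S z = 0}"
    then have "0 < norm (S u)" by simp
    moreover have "norm (S u) * (\<bar>Im u\<bar> * norm (T u)) \<le> norm (S u) * (A * (1 + norm u))"
      using A(2)[of u] fun_cong[OF T(2), of u] by (simp add: norm_mult mult_ac)
    ultimately show "\<bar>Im u\<bar> * norm (T u) \<le> A * (1 + norm u)"
      by (simp only: mult_le_cancel_left_pos)
  qed
  then show ?thesis using that[of c] T(2) by (simp add: mult.commute)
qed

text \<open>Although \<open>S\<close> may lie outside \<open>H\<close>, writing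
  \<open>z - x = (z - w) + (w - x)\<close> gives
  \<open>S / (z - w) = K + (w - x) K / (z - w)\<close>, and dividing \<open>K\<close> by a zero
  stays in \<open>H\<close>.\<close>

lemma divided_mem:
  assumes "S w = 0"
  obtains P where "P \<in> H" "P w \<noteq> 0" "S = (\<lambda>z. (z - w) * P z)"
proof -
  have *: "P w \<noteq> 0" if "P \<in> H" "S = (\<lambda>z. (z - w) * P z)" for P
    using S_simple_zeros[OF entire] that by blast
  show ?thesis
  proof (cases "w = of_real x")
    case True
    then have "S = (\<lambda>z. (z - w) * K z)" by (simp add: S_def fun_eq_iff)
    then show ?thesis using that * MH[OF K_mem] by blast
  next
    case False
    then have "K w = 0" using assms by (simp add: S_def)
    then obtain L where L: "L holomorphic_on UNIV" "K = (\<lambda>z. (z - w) * L z)"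
      using entire_divide[OF K_entire] by metis
    have LH: "L \<in> H" using divide_mem[OF L(1), of w] MH[OF K_mem] L(2) by simp
    define P where "P = K + (\<lambda>z. (w - of_real x) * L z)"
    have P: "P \<in> H" unfolding P_def by (rule add_mem[OF MH[OF K_mem] cmult_mem[OF LH]])
    have "S z = (z - w) * P z" for z
    proof -
      have "(z - w) * P z = (z - w) * K z + (w - of_real x) * ((z - w) * L z)"
        by (simp add: P_def algebra_simps)
      also have "(z - w) * L z = K z" using fun_cong[OF L(2), of z] by simp
      finally show ?thesis by (simp add: S_def algebra_simps)
    qed
    then have "S = (\<lambda>z. (z - w) * P z)" by (simp add: fun_eq_iff)
    then show ?thesis using that * P by blast
  qed
qed

lemma complete_minimal_extension:
  "\<exists>\<Lambda>\<^sub>2. complete_system E kern (\<Lambda> \<union> \<Lambda>\<^sub>2) \<and> minimal_system E kern (\<Lambda> \<union> \<Lambda>\<^sub>2)"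
proof -
  define Z where "Z = {z. S z = 0}"
  have Z: "\<Lambda> \<union> Z = Z" using S_zero by (auto simp: Z_def)
  show ?thesis
  proof (cases "S \<in> H")
    case False
    have "complete_system E kern Z"
    proof (rule ccontr)
      assume "\<not> complete_system E kern Z"
      then obtain F where F: "F \<in> H" "F \<noteq> 0" "\<And>z. z \<in> Z \<Longrightarrow> F z = 0"
        using incomplete_imp_annihilator by metis
      obtain c where c: "F = (\<lambda>z. c * S z)"
        using vanishing_imp_multiple[OF F(1)] F(3) by (auto simp: Z_def)
      have "c \<noteq> 0" using F(2) c by (auto simp: zero_fun_def)
      then have "S = (\<lambda>z. inverse c * F z)" by (simp add: c fun_eq_iff)
      then show False using False cmult_mem[OF F(1)] by metis
    qed
    moreover have "minimal_system E kern Z"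
      unfolding minimal_system_def
    proof
      fix w assume w: "w \<in> Z"
      then obtain P where P: "P \<in> H" "P w \<noteq> 0" "S = (\<lambda>z. (z - w) * P z)"
        using divided_mem unfolding Z_def by blast
      show "kern w \<notin> closed_span E kern (Z - {w})"
      proof (rule kernel_notin_closed_span[OF P(1) _ P(2)])
        fix v assume "v \<in> Z - {w}"
        then have "S v = 0" "v \<noteq> w" by (auto simp: Z_def)
        then show "P v = 0" using fun_cong[OF P(3), of v] by simp
      qed
    qed
    ultimately show ?thesis using Z by metis
  next
    case True
    \<comment> \<open>\<open>S\<close> now lies in \<open>H\<close> and vanishes on
      \<open>Z\<close>, so the kernels at \<open>Z\<close> alone are incomplete; one point where
      \<open>S\<close> is nonzero excludes the nonzero multiples of \<open>S\<close>.\<close>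
    obtain m where m: "S m \<noteq> 0" by (rule S_nonzero)
    define Y where "Y = insert m Z"
    have Y: "\<Lambda> \<union> Y = Y" using Z by (auto simp: Y_def)
    have "complete_system E kern Y"
    proof (rule ccontr)
      assume "\<not> complete_system E kern Y"
      then obtain F where F: "F \<in> H" "F \<noteq> 0" "\<And>z. z \<in> Y \<Longrightarrow> F z = 0"
        using incomplete_imp_annihilator by metis
      obtain c where c: "F = (\<lambda>z. c * S z)"
        using vanishing_imp_multiple[OF F(1)] F(3) by (auto simp: Y_def Z_def)
      have "c * S m = 0" using F(3)[of m] c by (simp add: Y_def)
      then have "c = 0" using m by simp
      then show False using F(2) c by (auto simp: zero_fun_def)
    qed
    moreover have "minimal_system E kern Y"
      unfolding minimal_system_def
    proof
      fix w assume w: "w \<in> Y"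
      show "kern w \<notin> closed_span E kern (Y - {w})"
      proof (cases "w = m")
        case True
        show ?thesis
        proof (rule kernel_notin_closed_span[OF \<open>S \<in> H\<close>])
          show "S v = 0" if "v \<in> Y - {w}" for v using that True by (auto simp: Y_def Z_def)
          show "S w \<noteq> 0" using m True by simp
        qed
      next
        case False
        then have "S w = 0" using w by (auto simp: Y_def Z_def)
        then obtain P where P: "P \<in> H" "P w \<noteq> 0" "S = (\<lambda>z. (z - w) * P z)"
          using divided_mem by blast
        \<comment> \<open>\<open>P\<close> need not vanish at the added point \<open>m\<close>, but
          \<open>(z - m) P(z)\<close> does; it lies in \<open>H\<close> because
          \<open>z - m = (z - w) + (w - m)\<close>.\<close>
        define R where "R = S + (\<lambda>z. (w - m) * P z)"
        have R: "R z = (z - m) * P z" for z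
          using fun_cong[OF P(3), of z] by (simp add: R_def algebra_simps)
        show ?thesis
        proof (rule kernel_notin_closed_span)
          show "R \<in> H" unfolding R_def by (intro add_mem \<open>S \<in> H\<close> cmult_mem P(1))
          show "R v = 0" if v: "v \<in> Y - {w}" for v
          proof (cases "v = m")
            case False
            then have "S v = 0" "v \<noteq> w" using v by (auto simp: Y_def Z_def)
            then show ?thesis using fun_cong[OF P(3), of v] by (simp add: R)
          qed (simp add: R)
          show "R w \<noteq> 0" using P(2) False by (simp add: R)
        qed
      qed
    qed
    ultimately show ?thesis using Y by metis
  qed
qed

end

context de_branges
begin

lemma exists_annihilator_kernel:
  assumes "annihilator \<Lambda> \<noteq> {0}"
  obtains x K where "annihilator_kernel E \<Lambda> x K"
proof -
  obtain F where F: "F \<in> annihilator \<Lambda>" "F \<noteq> 0"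
    using assms closed_subspaceD(2)[OF closed_subspace_annihilator] by blast
  \<comment> \<open>Countability of \<open>\<Lambda>\<close> is what leaves room for a real
    \<open>x\<close> outside all the exceptional sets.\<close>
  have \<Lambda>: "countable \<Lambda>"
    by (rule countable_subset[OF _ entire_countable_zeros[OF entire[OF annihilator_mem[OF F(1)]] F(2)]])
       (use F(1) in \<open>auto simp: annihilator_def\<close>)
  have "\<forall>w. \<exists>D. D \<in> annihilator \<Lambda> \<and> (\<forall>F\<in>annihilator \<Lambda>. ip F D = deriv F w)"
  proof
    fix w
    show "\<exists>D. D \<in> annihilator \<Lambda> \<and> (\<forall>F\<in>annihilator \<Lambda>. ip F D = deriv F w)"
      by (rule deriv_riesz[of \<Lambda> w]) blast
  qed
  from choice[OF this] obtain D where D: "\<And>w. D w \<in> annihilator \<Lambda>"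
      "\<And>w F. F \<in> annihilator \<Lambda> \<Longrightarrow> ip F (D w) = deriv F w"
    by blast
  \<comment> \<open>A function in the annihilator with a zero of order exactly 1 at \<open>w\<close>
    has nonzero derivative there, so the representer cannot be 0.\<close>
  have D0: "D w \<noteq> 0" if w: "w \<in> \<Lambda>" for w
  proof
    assume "D w = 0"
    obtain G where G: "G holomorphic_on UNIV" "G w \<noteq> 0" "(\<lambda>z. (z - w) * G z) \<in> annihilator \<Lambda>"
      using annihilator_simple_zero[OF assms w] .
    have "(G has_field_derivative deriv G w) (at w)" using G(1) by (intro holomorphic_derivI) auto
    then have "((\<lambda>z. (z - w) * G z) has_field_derivative G w) (at w)"
      by (auto intro!: derivative_eq_intros)
    then have "deriv (\<lambda>z. (z - w) * G z) w = G w" by (rule DERIV_imp_deriv)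
    then show False using D(2)[OF G(3), of w] \<open>D w = 0\<close> G(2) by (simp add: ip_zero)
  qed
  \<comment> \<open>Avoiding the zeros of \<open>F\<close> will give \<open>K \<noteq> 0\<close>;
    avoiding those of \<open>D w\<close> will give \<open>deriv K w \<noteq> 0\<close>.\<close>
  define B where "B = {t::real. F (of_real t) = 0} \<union> (\<Union>w\<in>\<Lambda>. {t::real. D w (of_real t) = 0})"
  have "countable B"
    unfolding B_def
    by (intro countable_Un countable_UN \<Lambda> entire_countable_real_zeros F(2) D0
        entire[OF annihilator_mem[OF F(1)]] entire[OF annihilator_mem[OF D(1)]])
  then have "\<not> UNIV \<subseteq> B" using countable_subset uncountable_UNIV_real by blast
  then obtain x where x: "x \<notin> B" by blast
  obtain K where K: "K \<in> annihilator \<Lambda>" "\<And>F. F \<in> annihilator \<Lambda> \<Longrightarrow> ip F K = F (of_real x)"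
    using eval_riesz by blast
  have "annihilator_kernel E \<Lambda> x K"
  proof unfold_locales
    have "ip F K \<noteq> 0" using K(2)[OF F(1)] x by (simp add: B_def)
    then have "K \<noteq> 0" by (auto simp: ip_zero)
    \<comment> \<open>The value of \<open>K\<close> at its own point is
      \<open>ip K K\<close>.\<close>
    then show "K (of_real x) \<noteq> 0"
      using eq_zero_if_orthogonal_self[OF annihilator_mem[OF K(1)]] K(2)[OF K(1)] by auto
    show "deriv K w \<noteq> 0" if "w \<in> \<Lambda>" "Im w = 0" for w
    proof -
      \<comment> \<open>\<open>ip K (D w)\<close> is the derivative of \<open>K\<close> at
        \<open>w\<close>, and its conjugate \<open>ip (D w) K\<close> is the value of
        \<open>D w\<close> at \<open>x\<close>.\<close>
      have "deriv K w = cnj (D w (of_real x))"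
        using D(2)[OF K(1), of w] K(2)[OF D(1), of w] ip_cnj[of K "D w"] by simp
      then show ?thesis using x that(1) by (auto simp: B_def)
    qed
  qed (use K in auto)
  then show ?thesis by (rule that)
qed

end

theorem theorem3p2:
  fixes E :: "complex \<Rightarrow> complex" and \<Lambda>\<^sub>1 :: "complex set"
  assumes "hermite_biehler E"
    and "\<And>x::real. E (complex_of_real x) \<noteq> 0"
    and "\<not> complete_system E (reproducing_kernel E) \<Lambda>\<^sub>1"
  shows "\<exists>\<Lambda>\<^sub>2 :: complex set.
    complete_system E (reproducing_kernel E) (\<Lambda>\<^sub>1 \<union> \<Lambda>\<^sub>2) \<and>
    minimal_system E (reproducing_kernel E) (\<Lambda>\<^sub>1 \<union> \<Lambda>\<^sub>2)"
proof -
  interpret de_branges E by unfold_locales (use assms in auto)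
  obtain F where "F \<in> H" "F \<noteq> 0" "\<And>z. z \<in> \<Lambda>\<^sub>1 \<Longrightarrow> F z = 0"
    using incomplete_imp_annihilator[OF assms(3)] by blast
  then have "F \<in> annihilator \<Lambda>\<^sub>1" "F \<noteq> 0" by (auto simp: annihilator_def)
  then have "annihilator \<Lambda>\<^sub>1 \<noteq> {0}" by blast
  then obtain x K where "annihilator_kernel E \<Lambda>\<^sub>1 x K"
    using exists_annihilator_kernel by blast
  then interpret annihilator_kernel E \<Lambda>\<^sub>1 x K .
  show ?thesis by (rule complete_minimal_extension)
qed

end
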